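(* Let $m_0\in\mathcal{M}(\mathbb{T})$ and $y_0=\Phi m_0$. Assume that there exists a solution to $\mathcal{D}_0(y_0)$ and let $\epsilon>0$. Then there exist $\alpha>0$ and $\lambda_0>0$ such that for all $(\lambda,w)\in D_{\alpha,\lambda_0}$ and every solution $\tilde m_\lambda$ of $\mathcal{P}_\lambda(y_0+w)$, $$\operatorname{supp}^{\pm}\tilde m_\lambda\subset\operatorname{Ext}^{\pm}(m_0)\oplus\big((-\epsilon,+\epsilon)\times\{0\}\big),$$ where $A\oplus B=\{a+b:a\in A,b\in B\}$ denotes the Minkowski sum (so the right-hand side is $\{(t+s,v):(t,v)\in\operatorname{Ext}^{\pm}(m_0),\ |s|<\epsilon\}$).
   Context: $\mathbb{T}=\mathbb{R}/\mathbb{Z}$. $\mathcal{M}(\mathbb{T})$ is the space of real Radon measures on $\mathbb{T}$ and $\|m\|_{TV}=\sup\{\int\psi\,dm:\psi\in C(\mathbb{T}),\|\psi\|_\infty\le1\}$. Fix a real-valued $\varphi\in C^2(\mathbb{T})$ and let $\Phi:\mathcal{M}(\mathbb{T})\to L^2(\mathbb{T})$, $(\Phi m)(t)=\int_{\mathbb{T}}\varphi(x-t)\,dm(x)$, with adjoint $\Phi^*:L^2(\mathbb{T})\to C(\mathbb{T})$, $(\Phi^*p)(t)=\int_{\mathbb{T}}\varphi(t-x)p(x)\,dx$. For $y\in L^2(\mathbb{T})$: for $\lambda>0$, $\mathcal{P}_\lambda(y)$ is the problem $\min_{m\in\mathcal{M}(\mathbb{T})}\frac12\|\Phi m-y\|_2^2+\lambda\|m\|_{TV}$;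 $\mathcal{P}_0(y)$ is $\min_{\Phi m=y}\|m\|_{TV}$; $\mathcal{D}_0(y)$ is $\sup\{\langle y,p\rangle:p\in L^2(\mathbb{T}),\ \|\Phi^*p\|_\infty\le1\}$. $D_{\alpha,\lambda_0}=\{(\lambda,w)\in\mathbb{R}_+\times L^2(\mathbb{T}):0\le\lambda\le\lambda_0,\ \|w\|_2\le\alpha\lambda\}$. The signed support of $m\in\mathcal{M}(\mathbb{T})$ is $\operatorname{supp}^{\pm}m=(\operatorname{supp}m_+)\times\{1\}\cup(\operatorname{supp}m_-)\times\{-1\}$, where $m_\pm$ are the positive and negative parts of $m$. The minimal norm certificate is $\eta_0=\Phi^*p_0$, where $p_0$ is the solution of $\mathcal{D}_0(y_0)$ of minimal $L^2$ norm. The extended signed support of $m_0$ is $\operatorname{Ext}^{\pm}(m_0)=\{(t,v)\in\mathbb{T}\times\{+1,-1\}:\eta_0(t)=v\}$. *)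

theory Defs
  imports "HOL-Analysis.Analysis" "HOL-Library.Set_Algebras"
begin

section \<open>The torus R/Z\<close>

quotient_type torus = real / "\<lambda>x y. x - y \<in> \<int>"
  morphisms rep_torus to_torus
proof (rule equivpI)
  show "reflp (\<lambda>x y::real. x - y \<in> \<int>)"
    by (rule reflpI) simp
  show "symp (\<lambda>x y::real. x - y \<in> \<int>)"
    by (rule sympI) (metis Ints_minus minus_diff_eq)
  show "transp (\<lambda>x y::real. x - y \<in> \<int>)"
  proof (rule transpI)
    fix x y z :: real assume "x - y \<in> \<int>" "y - z \<in> \<int>"
    then have "(x - y) + (y - z) \<in> \<int>" by (rule Ints_add)
    then show "x - z \<in> \<int>" by simp
  qed
qed

instantiation torus :: ab_group_add
begin

lift_definition zero_torus :: torus is "0::real" .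

lift_definition plus_torus :: "torus \<Rightarrow> torus \<Rightarrow> torus" is "\<lambda>x y::real. x + y"
proof -
  fix a b c d :: real assume "a - b \<in> \<int>" "c - d \<in> \<int>"
  then have "(a - b) + (c - d) \<in> \<int>" by (rule Ints_add)
  then show "a + c - (b + d) \<in> \<int>" by (simp add: algebra_simps)
qed

lift_definition uminus_torus :: "torus \<Rightarrow> torus" is "\<lambda>x::real. - x"
  by (metis Ints_minus minus_diff_eq minus_diff_minus)

lift_definition minus_torus :: "torus \<Rightarrow> torus \<Rightarrow> torus" is "\<lambda>x y::real. x - y"
proof -
  fix a b c d :: real assume "a - b \<in> \<int>" "c - d \<in> \<int>"
  then have "(a - b) - (c - d) \<in> \<int>" by (rule Ints_diff)
  then show "a - c - (b - d) \<in> \<int>" by (simp add: algebra_simps)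
qed

instance
  by standard (transfer, simp)+

end

lemma round_add_Ints:
  fixes z k :: real
  assumes "k \<in> \<int>"
  shows "z + k - of_int (round (z + k)) = z - of_int (round z)"
proof -
  obtain n where "k = of_int n" using assms by (auto elim: Ints_cases)
  moreover have "round (z + of_int n) = round z + n"
    using floor_add_int[of "z + 1/2" n] by (simp add: round_def algebra_simps)
  ultimately show ?thesis by simp
qed

instantiation torus :: metric_space
begin

text \<open>The quotient metric: the distance from \<open>x - y\<close> to the nearest integer.\<close>

lift_definition dist_torus :: "torus \<Rightarrow> torus \<Rightarrow> real"
  is "\<lambda>x y. \<bar>(x - y) - of_int (round (x - y))\<bar>"
proof -
  fix a b c d :: real assume "a - b \<in> \<int>" "c - d \<in> \<int>"
  then have "(a - b) - (c - d) \<in> \<int>" by (rule Ints_diff)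
  from round_add_Ints[OF this, of "b - d"]
  show "\<bar>a - c - of_int (round (a - c))\<bar> = \<bar>b - d - of_int (round (b - d))\<bar>"
    by (simp add: algebra_simps)
qed

definition uniformity_torus :: "(torus \<times> torus) filter"
  where "uniformity_torus = (INF e\<in>{0 <..}. principal {(x, y). dist x y < e})"

definition open_torus :: "torus set \<Rightarrow> bool"
  where "open_torus U \<longleftrightarrow> (\<forall>x\<in>U. eventually (\<lambda>(x', y). x' = x \<longrightarrow> y \<in> U) uniformity)"

instance
proof
  fix x y z :: torus
  show "uniformity = (INF e\<in>{0 <..}. principal {(x::torus, y). dist x y < e})"
    by (rule uniformity_torus_def)
  show "open U \<longleftrightarrow> (\<forall>x\<in>U. eventually (\<lambda>(x', y). x' = x \<longrightarrow> y \<in> U) uniformity)"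
    for U :: "torus set"
    by (rule open_torus_def)
  show "dist x y = 0 \<longleftrightarrow> x = y"
  proof (transfer)
    fix x y :: real
    show "\<bar>x - y - of_int (round (x - y))\<bar> = 0 \<longleftrightarrow> x - y \<in> \<int>"
    proof
      assume "\<bar>x - y - of_int (round (x - y))\<bar> = 0"
      then have "x - y = of_int (round (x - y))" by linarith
      then show "x - y \<in> \<int>" by (metis Ints_of_int)
    next
      assume "x - y \<in> \<int>"
      then obtain k where "x - y = of_int k" by (rule Ints_cases)
      then show "\<bar>x - y - of_int (round (x - y))\<bar> = 0" by simp
    qed
  qed
  show "dist x y \<le> dist x z + dist y z"
  proof (transfer)
    fix x y z :: real
    have "\<bar>x - y - of_int (round (x - y))\<bar>
        \<le> \<bar>x - y - of_int (round (x - z) - round (y - z))\<bar>"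
      by (rule round_diff_minimal)
    also have "\<dots> \<le> \<bar>x - z - of_int (round (x - z))\<bar> + \<bar>y - z - of_int (round (y - z))\<bar>"
      by simp
    finally show "\<bar>x - y - of_int (round (x - y))\<bar>
      \<le> \<bar>x - z - of_int (round (x - z))\<bar> + \<bar>y - z - of_int (round (y - z))\<bar>" .
  qed
qed

end

lemma dist_to_torus_le: "dist (to_torus a) (to_torus b) \<le> \<bar>a - b\<bar>"
  using round_diff_minimal[of "a - b" 0] by (simp add: dist_torus.abs_eq)

lemma continuous_on_to_torus: "continuous_on A to_torus"
  unfolding continuous_on_iff dist_real_def
  by (meson dist_to_torus_le le_less_trans)

lemma to_torus_surj: "\<exists>r. x = to_torus r"
  by (metis Quotient_torus Quotient_abs_rep)

lemma dist_torus_witness: "\<exists>r. to_torus r = y \<and> \<bar>r - a\<bar> = dist y (to_torus a)"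
proof -
  obtain b where b: "y = to_torus b" using to_torus_surj by blast
  let ?r = "b - of_int (round (b - a))"
  have "to_torus ?r = y"
    by (simp add: b torus.abs_eq_iff)
  moreover have "\<bar>?r - a\<bar> = dist y (to_torus a)"
    by (simp add: b dist_torus.abs_eq algebra_simps)
  ultimately show ?thesis by blast
qed

text \<open>The metric induces the quotient topology.\<close>

lemma open_torus_iff_vimage: "open U \<longleftrightarrow> open (to_torus -` U)"
proof
  assume "open U"
  then show "open (to_torus -` U)"
    using continuous_on_to_torus by (rule open_vimage)
next
  assume L: "open (to_torus -` U)"
  show "open U"
  proof (unfold open_dist, intro ballI)
    fix x assume "x \<in> U"
    obtain a where a: "x = to_torus a" using to_torus_surj by blast
    with \<open>x \<in> U\<close> have "a \<in> to_torus -` U" by simp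
    with L obtain e where "e > 0" and "\<forall>r. dist r a < e \<longrightarrow> r \<in> to_torus -` U"
      by (meson open_dist)
    then have e: "e > 0" "\<And>r. dist r a < e \<Longrightarrow> to_torus r \<in> U" by simp_all
    have "y \<in> U" if "dist y x < e" for y
    proof -
      obtain r where "to_torus r = y" "\<bar>r - a\<bar> = dist y (to_torus a)"
        using dist_torus_witness by blast
      with that e(2)[of r] show ?thesis by (simp add: a dist_real_def)
    qed
    with e(1) show "\<exists>e>0. \<forall>y. dist y x < e \<longrightarrow> y \<in> U" by blast
  qed
qed

text \<open>Lebesgue (normalised Haar) measure.\<close>

definition haar :: "torus measure"
  where "haar = distr (restrict_space lborel {0..<1}) borel to_torus"

definition C2_torus :: "(torus \<Rightarrow> real) \<Rightarrow> bool"
  where "C2_torus f \<longleftrightarrow> (\<exists>f' f'' :: real \<Rightarrow> real.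
    (\<forall>x. ((\<lambda>s. f (to_torus s)) has_real_derivative f' x) (at x)) \<and>
    (\<forall>x. (f' has_real_derivative f'' x) (at x)) \<and>
    continuous_on UNIV f'')"

definition sup_norm :: "(torus \<Rightarrow> real) \<Rightarrow> real"
  where "sup_norm f = (SUP x. \<bar>f x\<bar>)"


section \<open>Real Radon measures\<close>

text \<open>
  On the compact metric space \<^typ>\<open>torus\<close> every finite Borel measure is regular, so the real Radon
  measures are exactly the real-valued countably additive set functions on the Borel sets.
  Their values on non-Borel sets are fixed to be 0.
\<close>

definition radon_measures :: "(torus set \<Rightarrow> real) set"
  where "radon_measures = {m.
    (\<forall>A. A \<notin> sets borel \<longrightarrow> m A = 0) \<and> m {} = 0 \<and>
    (\<forall>A :: nat \<Rightarrow> torus set. range A \<subseteq> sets borel \<longrightarrow> disjoint_family A \<longrightarrow>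
      (\<lambda>i. m (A i)) sums m (\<Union>i. A i))}"

text \<open>
  The positive and negative parts of the Jordan decomposition, by
  \<open>m\<^sub>+ A = sup {m B | B \<subseteq> A}\<close> and \<open>m\<^sub>- = (- m)\<^sub>+\<close>.
  As \<open>m {} = 0\<close>, the truncation of negative values by \<^const>\<open>ennreal\<close> does not affect the supremum.
\<close>

definition pos_part :: "(torus set \<Rightarrow> real) \<Rightarrow> torus measure"
  where "pos_part m = measure_of UNIV (sets borel)
    (\<lambda>A. SUP B\<in>{B \<in> sets borel. B \<subseteq> A}. ennreal (m B))"

definition neg_part :: "(torus set \<Rightarrow> real) \<Rightarrow> torus measure"
  where "neg_part m = pos_part (\<lambda>A. - m A)"

definition signed_integral :: "(torus set \<Rightarrow> real) \<Rightarrow> (torus \<Rightarrow> real) \<Rightarrow> real"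
  where "signed_integral m f = integral\<^sup>L (pos_part m) f - integral\<^sup>L (neg_part m) f"

definition tv_norm :: "(torus set \<Rightarrow> real) \<Rightarrow> real"
  where "tv_norm m = (SUP \<psi>\<in>{\<psi>. continuous_on UNIV \<psi> \<and> sup_norm \<psi> \<le> 1}. signed_integral m \<psi>)"

definition measure_supp :: "torus measure \<Rightarrow> torus set"
  where "measure_supp \<mu> = {x. \<forall>U. open U \<longrightarrow> x \<in> U \<longrightarrow> emeasure \<mu> U \<noteq> 0}"

definition signed_supp :: "(torus set \<Rightarrow> real) \<Rightarrow> (torus \<times> real) set"
  where "signed_supp m = measure_supp (pos_part m) \<times> {1} \<union> measure_supp (neg_part m) \<times> {-1}"


section \<open>Square-integrable functions\<close>

text \<open>
  Elements of \<open>L\<^sup>2\<close> are given by Borel representatives; their equality is \<open>AE x in haar\<close>.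
\<close>

definition L2 :: "(torus \<Rightarrow> real) set"
  where "L2 = {p \<in> borel_measurable borel. integrable haar (\<lambda>x. (p x)\<^sup>2)}"

definition l2_inner :: "(torus \<Rightarrow> real) \<Rightarrow> (torus \<Rightarrow> real) \<Rightarrow> real"
  where "l2_inner p q = (\<integral>x. p x * q x \<partial>haar)"

definition l2_norm :: "(torus \<Rightarrow> real) \<Rightarrow> real"
  where "l2_norm p = sqrt (l2_inner p p)"


section \<open>The operator, its adjoint, and the optimisation problems\<close>

definition Phi :: "(torus \<Rightarrow> real) \<Rightarrow> (torus set \<Rightarrow> real) \<Rightarrow> torus \<Rightarrow> real"
  where "Phi \<phi> m t = signed_integral m (\<lambda>x. \<phi> (x - t))"

definition Phi_adj :: "(torus \<Rightarrow> real) \<Rightarrow> (torus \<Rightarrow> real) \<Rightarrow> torus \<Rightarrow> real"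
  where "Phi_adj \<phi> p t = (\<integral>x. \<phi> (t - x) * p x \<partial>haar)"

definition P_energy ::
    "(torus \<Rightarrow> real) \<Rightarrow> real \<Rightarrow> (torus \<Rightarrow> real) \<Rightarrow> (torus set \<Rightarrow> real) \<Rightarrow> real"
  where "P_energy \<phi> l y m = 1/2 * (l2_norm (\<lambda>t. Phi \<phi> m t - y t))\<^sup>2 + l * tv_norm m"

definition P0_feasible :: "(torus \<Rightarrow> real) \<Rightarrow> (torus \<Rightarrow> real) \<Rightarrow> (torus set \<Rightarrow> real) set"
  where "P0_feasible \<phi> y = {m \<in> radon_measures. AE t in haar. Phi \<phi> m t = y t}"

definition solves_P ::
    "(torus \<Rightarrow> real) \<Rightarrow> real \<Rightarrow> (torus \<Rightarrow> real) \<Rightarrow> (torus set \<Rightarrow> real) \<Rightarrow> bool"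
  where "solves_P \<phi> l y m \<longleftrightarrow>
    (if l = 0 then m \<in> P0_feasible \<phi> y \<and> (\<forall>m'\<in>P0_feasible \<phi> y. tv_norm m \<le> tv_norm m')
     else m \<in> radon_measures \<and> (\<forall>m'\<in>radon_measures. P_energy \<phi> l y m \<le> P_energy \<phi> l y m'))"

definition D0_feasible :: "(torus \<Rightarrow> real) \<Rightarrow> (torus \<Rightarrow> real) set"
  where "D0_feasible \<phi> = {p \<in> L2. sup_norm (Phi_adj \<phi> p) \<le> 1}"

definition solves_D0 :: "(torus \<Rightarrow> real) \<Rightarrow> (torus \<Rightarrow> real) \<Rightarrow> (torus \<Rightarrow> real) \<Rightarrow> bool"
  where "solves_D0 \<phi> y p \<longleftrightarrow>
    p \<in> D0_feasible \<phi> \<and> (\<forall>q\<in>D0_feasible \<phi>. l2_inner y q \<le> l2_inner y p)"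

definition min_norm_solves_D0 :: "(torus \<Rightarrow> real) \<Rightarrow> (torus \<Rightarrow> real) \<Rightarrow> (torus \<Rightarrow> real) \<Rightarrow> bool"
  where "min_norm_solves_D0 \<phi> y p \<longleftrightarrow>
    solves_D0 \<phi> y p \<and> (\<forall>q. solves_D0 \<phi> y q \<longrightarrow> l2_norm p \<le> l2_norm q)"

text \<open>
  The minimal-norm solution is unique up to \<^const>\<open>haar\<close>-null sets, which
  \<^const>\<open>Phi_adj\<close> does not see; so \<open>\<eta>\<^sub>0\<close> does not depend on the representative chosen.
\<close>

definition min_norm_certificate :: "(torus \<Rightarrow> real) \<Rightarrow> (torus \<Rightarrow> real) \<Rightarrow> torus \<Rightarrow> real"
  where "min_norm_certificate \<phi> y = Phi_adj \<phi> (SOME p. min_norm_solves_D0 \<phi> y p)"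

definition ext_signed_supp :: "(torus \<Rightarrow> real) \<Rightarrow> (torus set \<Rightarrow> real) \<Rightarrow> (torus \<times> real) set"
  where "ext_signed_supp \<phi> m\<^sub>0 =
    {(t, v). v \<in> {1, -1} \<and> min_norm_certificate \<phi> (Phi \<phi> m\<^sub>0) t = v}"

definition noise_region :: "real \<Rightarrow> real \<Rightarrow> (real \<times> (torus \<Rightarrow> real)) set"
  where "noise_region \<alpha> l\<^sub>0 = {(l, w). w \<in> L2 \<and> 0 \<le> l \<and> l \<le> l\<^sub>0 \<and> l2_norm w \<le> \<alpha> * l}"

end

theory Submission
  imports Defs "HOL-Probability.Giry_Monad" "HOL-Probability.Helly_Selection"
begin

text \<open>
  For \<open>\<lambda> > 0\<close> the dual certificate \<open>p = (y\<^sub>0 + w - \<Phi> m) / \<lambda>\<close> of a solution \<open>m\<close> is feasible for the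
  dual problem, and \<open>\<Phi>\<^sup>* p\<close> equals \<open>\<plusminus>1\<close> on the supports of the two parts of \<open>m\<close>. Testing
  optimality against \<open>p\<^sub>0\<close> gives \<open>\<parallel>p\<parallel> \<le> \<parallel>p\<^sub>0\<parallel> + O(\<alpha>)\<close> and \<open>\<langle>y\<^sub>0, p\<rangle> \<ge> \<langle>y\<^sub>0, p\<^sub>0\<rangle> - O(\<lambda>)\<close>; since \<open>p\<^sub>0\<close> is
  the limit of the elements of least norm in the slices of almost optimal dual vectors, the
  parallelogram law makes \<open>p\<close> close to \<open>p\<^sub>0\<close> in \<open>L\<^sup>2\<close>, hence \<open>\<Phi>\<^sup>* p\<close> uniformly close to \<open>\<eta>\<^sub>0\<close>. By compactness
  of the torus, \<open>\<eta>\<^sub>0\<close> is bounded away from \<open>\<plusminus>1\<close> outside the \<open>\<epsilon>\<close>-neighbourhood of the extended support.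
  For \<open>\<lambda> = 0\<close> one has \<open>w = 0\<close> almost everywhere and \<open>p\<^sub>0\<close> itself serves as \<open>p\<close>: by strong duality, the
  total variation of a solution is \<open>\<langle>y\<^sub>0, p\<^sub>0\<rangle>\<close>. Strong duality rests on weak-* compactness of balls of
  measures, obtained from Helly's selection theorem on the fundamental domain \<open>[0, 1)\<close>.
\<close>

section \<open>The torus\<close>

text \<open>Total variation is defined by duality with continuous functions, the signed support by
  the Jordan parts. The identity of \<open>tv_norm\<close> with \<open>total_mass\<close> joins the
  two views: it is what makes a saturated certificate equal to 1 and -1 on the respective supports.
  The measure \<open>m\<^sub>0\<close> is arbitrary, not a solution of the limit problem, and only
  some dual solution is given. So the minimal norm certificate has to be constructed, and at
  \<lambda> = 0 the primal value has to be compared with the dual one: the misfit is minimised over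
  the ball whose radius is the dual value, and its residual is shown to vanish. For \<lambda> > 0
  the two parameters have separate tasks. The size of \<alpha> keeps the norm of p close to that of
  p0, the size of \<lambda> keeps p in a slice of almost optimal dual vectors. The midpoint of p and
  p0 then lies in that slice and cannot be much shorter than p0, while neither endpoint is much
  longer; the parallelogram law turns this into closeness.\<close>

lemma to_torus_add: "to_torus a + to_torus b = to_torus (a + b)"
  by (simp add: plus_torus.abs_eq)

lemma to_torus_of_int: "to_torus (a + of_int k) = to_torus a"
  by (simp add: torus.abs_eq_iff)

lemma to_torus_frac: "to_torus (frac a) = to_torus a"
  by (simp add: torus.abs_eq_iff frac_def)

text \<open>The preimage of the image is the union of all integer translates of \<open>U\<close>.
  Openness of the quotient map carries a countable basis of the line over to the torus.\<close>

lemma open_to_torus_image: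
  assumes "open U"
  shows "open (to_torus ` U)"
proof -
  have "to_torus -` (to_torus ` U) = (\<Union>k::int. (\<lambda>x. x + of_int k) -` U)"
  proof (intro set_eqI iffI)
    fix x assume "x \<in> to_torus -` (to_torus ` U)"
    then obtain u where u: "u \<in> U" "u - x \<in> \<int>" by (metis vimage_eq imageE torus.abs_eq_iff)
    then obtain k where "u - x = of_int k" by (auto elim: Ints_cases)
    then have "u = x + of_int k" by simp
    with u show "x \<in> (\<Union>k::int. (\<lambda>x. x + of_int k) -` U)" by auto
  next
    fix x assume "x \<in> (\<Union>k::int. (\<lambda>x. x + of_int k) -` U)"
    then obtain k where "x + of_int k \<in> U" by auto
    then show "x \<in> to_torus -` (to_torus ` U)" by (metis imageI to_torus_of_int vimage_eq)
  qed
  moreover have "open (\<Union>k::int. (\<lambda>x. x + of_int k) -` U)"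
    by (intro open_UN ballI open_vimage assms continuous_intros)
  ultimately show ?thesis by (simp add: open_torus_iff_vimage)
qed

text \<open>A countable basis makes the Borel sets of the product the product sigma-algebra, which
  joint measurability of the kernel rests on; together with completeness it gives inner regularity
  of finite Borel measures.\<close>

instance torus :: second_countable_topology
proof
  obtain B :: "real set set" where B: "countable B" "topological_basis B"
    using ex_countable_basis by blast
  have "topological_basis ((\<lambda>U. to_torus ` U) ` B)"
  proof (rule topological_basisI)
    show "open U" if "U \<in> (\<lambda>U. to_torus ` U) ` B" for U
      using that B(2) open_to_torus_image topological_basis_open by auto
    fix U :: "torus set" and x assume U: "open U" "x \<in> U"
    obtain a where a: "x = to_torus a" using to_torus_surj by blast
    have "open (to_torus -` U)" "a \<in> to_torus -` U"
      using U a open_torus_iff_vimage by auto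
    then obtain V where "V \<in> B" "a \<in> V" "V \<subseteq> to_torus -` U"
      using B(2) topological_basisE by blast
    then show "\<exists>V\<in>(\<lambda>U. to_torus ` U) ` B. x \<in> V \<and> V \<subseteq> U"
      using a by (intro bexI[of _ "to_torus ` V"]) auto
  qed
  with B(1) show "\<exists>B::torus set set. countable B \<and> open = generate_topology B"
    by (metis countable_image topological_basis_imp_subbasis)
qed

section \<open>Compactness of the torus, translations, and continuous functions\<close>

lemma compact_torus_UNIV: "compact (UNIV :: torus set)"
proof -
  have "x \<in> to_torus ` {0..1}" for x
  proof -
    obtain a where "x = to_torus a" using to_torus_surj by blast
    then have "x = to_torus (frac a)" by (simp add: to_torus_frac)
    then show ?thesis using frac_lt_1[of a] by (auto intro!: image_eqI)
  qed
  then have "to_torus ` {0..1} = UNIV" by auto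
  then show ?thesis
    by (metis compact_Icc compact_continuous_image continuous_on_to_torus)
qed

lemma compact_torus: "closed K \<Longrightarrow> compact K" for K :: "torus set"
  using compact_Int_closed[OF compact_torus_UNIV] by simp

instance torus :: complete_space
proof
  fix X :: "nat \<Rightarrow> torus" assume "Cauchy X"
  then show "convergent X"
    using compact_imp_complete[OF compact_torus_UNIV] unfolding complete_def convergent_def by blast
qed

lemma dist_torus_diff_left: "dist (t - x) (t - y) = dist x y" for t :: torus
proof -
  obtain a b c where "x = to_torus a" "y = to_torus b" "t = to_torus c" using to_torus_surj by metis
  then have "dist (t - x) (t - y) = dist y x" by (simp add: minus_torus.abs_eq dist_torus.abs_eq)
  then show ?thesis by (simp add: dist_commute)
qed

lemma dist_torus_diff_right: "dist (x - t) (y - t) = dist x y" for t :: torus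
proof -
  obtain a b c where "x = to_torus a" "y = to_torus b" "t = to_torus c" using to_torus_surj by metis
  then show ?thesis by (simp add: minus_torus.abs_eq dist_torus.abs_eq)
qed

lemma dist_torus_diff: "dist (x - t) (x' - t') \<le> dist x x' + dist t t'" for t :: torus
proof -
  have "dist (x - t) (x' - t') \<le> dist (x - t) (x' - t) + dist (x' - t) (x' - t')"
    by (rule dist_triangle)
  then show ?thesis by (simp add: dist_torus_diff_left dist_torus_diff_right)
qed

lemma continuous_on_torus_minus: "continuous_on UNIV (\<lambda>z. fst z - snd z :: torus)"
proof (rule continuous_onI)
  fix z :: "torus \<times> torus" and e :: real assume e: "0 < e"
  show "\<exists>d>0. \<forall>z'\<in>UNIV. dist z' z < d \<longrightarrow> dist (fst z' - snd z') (fst z - snd z) \<le> e"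
  proof (intro exI[of _ "e/2"] conjI ballI impI)
    fix z' assume "dist z' z < e/2"
    moreover have "dist (fst z' - snd z') (fst z - snd z) \<le> dist (fst z') (fst z) + dist (snd z') (snd z)"
      by (rule dist_torus_diff)
    ultimately show "dist (fst z' - snd z') (fst z - snd z) \<le> e"
      using dist_fst_le[of z' z] dist_snd_le[of z' z] by linarith
  qed (use e in simp)
qed

lemma continuous_bounded_torus:
  fixes f :: "torus \<Rightarrow> real"
  assumes "continuous_on UNIV f"
  shows "\<exists>B>0. \<forall>x. \<bar>f x\<bar> \<le> B"
proof -
  have "bounded (range f)"
    using assms compact_continuous_image compact_imp_bounded compact_torus_UNIV by blast
  then show ?thesis by (auto simp: bounded_pos)
qed

lemma sup_norm_le_iff:
  assumes "continuous_on UNIV f"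
  shows "sup_norm f \<le> c \<longleftrightarrow> (\<forall>x. \<bar>f x\<bar> \<le> c)"
proof -
  have "bdd_above (range (\<lambda>x. \<bar>f x\<bar>))"
    using continuous_bounded_torus[OF assms] by (auto intro: bdd_aboveI2)
  then show ?thesis unfolding sup_norm_def by (subst cSUP_le_iff) auto
qed

lemma abs_le_sup_norm: "continuous_on UNIV f \<Longrightarrow> \<bar>f x\<bar> \<le> sup_norm f"
  using sup_norm_le_iff by blast

text \<open>Continuity descends from the line because a subset of the torus is open exactly when its
  preimage is.\<close>

lemma C2_torus_continuous:
  assumes "C2_torus f"
  shows "continuous_on UNIV f"
proof -
  from assms have "isCont (\<lambda>s. f (to_torus s)) x" for x
    unfolding C2_torus_def using DERIV_isCont by blast
  then have c: "continuous_on UNIV (\<lambda>s. f (to_torus s))"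
    by (simp add: continuous_at_imp_continuous_on)
  have "open (f -` U)" if "open U" for U
  proof -
    have "open ((\<lambda>s. f (to_torus s)) -` U)" using that c by (rule open_vimage)
    then show ?thesis by (simp add: open_torus_iff_vimage vimage_def)
  qed
  then show ?thesis by (simp add: continuous_on_open_vimage)
qed

text \<open>A Borel right inverse of \<open>to_torus\<close> with values in [0, 1). It moves
  measures from the torus to the line, where Helly's theorem applies.\<close>

definition torus_section :: "torus \<Rightarrow> real"
  where "torus_section x = frac (rep_torus x)"

lemma to_torus_section [simp]: "to_torus (torus_section x) = x"
  unfolding torus_section_def to_torus_frac by (rule Quotient_abs_rep[OF Quotient_torus])

lemma torus_section_bounds: "0 \<le> torus_section x" "torus_section x < 1"
  by (simp_all add: torus_section_def frac_lt_1)

lemma torus_section_to_torus: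
  assumes "0 \<le> a" "a < 1"
  shows "torus_section (to_torus a) = a"
proof -
  let ?b = "torus_section (to_torus a)"
  have "?b - a \<in> \<int>" by (metis to_torus_section torus.abs_eq_iff)
  then obtain k where k: "?b - a = of_int k" by (rule Ints_cases)
  with assms torus_section_bounds[of "to_torus a"] have "real_of_int k < 1" "real_of_int k > -1"
    by linarith+
  then have "k = 0" by linarith
  with k show ?thesis by simp
qed

lemma measurable_torus_section [measurable]: "torus_section \<in> borel_measurable borel"
proof (rule borel_measurableI_le)
  fix a
  show "{x \<in> space borel. torus_section x \<le> a} \<in> sets borel"
  proof (cases "a < 1")
    case True
    \<comment> \<open>Below 1 the sublevel set is the image of a compact interval (empty for
      negative \<open>a\<close>), hence closed, although the section jumps at the class of
      0.\<close>
    have "{x \<in> space borel. torus_section x \<le> a} = to_torus ` {0..a}"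
      using True torus_section_bounds
      by (auto simp: torus_section_to_torus intro!: image_eqI[of _ to_torus "torus_section _"])
    also have "compact (to_torus ` {0..a})"
      by (intro compact_continuous_image continuous_on_to_torus compact_Icc)
    finally show ?thesis by (intro borel_closed compact_imp_closed)
  next
    case False
    then have "{x \<in> space borel. torus_section x \<le> a} = UNIV"
      using torus_section_bounds(2) by (force intro: order_trans[OF less_imp_le])
    then show ?thesis by simp
  qed
qed

lemma measurable_to_torus [measurable]: "to_torus \<in> borel_measurable borel"
  by (intro borel_measurable_continuous_onI continuous_on_to_torus)

section \<open>Normalised Haar measure as a probability measure\<close>

lemma sets_haar [simp, measurable_cong]: "sets haar = sets borel"
  by (simp add: haar_def)

lemma space_haar [simp]: "space haar = UNIV"
  by (simp add: haar_def)

lemma prob_space_haar: "prob_space haar"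
proof -
  have "prob_space (restrict_space lborel {0..<1::real})"
    by (rule prob_spaceI) (simp add: emeasure_restrict_space space_restrict_space)
  then show ?thesis
    unfolding haar_def by (rule prob_space.prob_space_distr) (auto intro: measurable_restrict_space1)
qed

section \<open>Jordan decomposition of real Radon measures\<close>

lemma radon_empty: "m \<in> radon_measures \<Longrightarrow> m {} = 0"
  by (simp add: radon_measures_def)

lemma radon_sums:
  assumes "m \<in> radon_measures" "range A \<subseteq> sets borel" "disjoint_family A"
  shows "(\<lambda>i. m (A i)) sums m (\<Union>i. A i)"
  using assms by (simp add: radon_measures_def)

lemma radon_Un:
  assumes m: "m \<in> radon_measures" and A: "A \<in> sets borel" "B \<in> sets borel" "A \<inter> B = {}"
  shows "m (A \<union> B) = m A + m B"
proof -
  have "(\<lambda>i. m (binaryset A B i)) sums m (\<Union>i. binaryset A B i)"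
    using A by (intro radon_sums[OF m]) (auto simp: range_binaryset_eq disjoint_family_on_def binaryset_def)
  moreover have "(\<lambda>i. m (binaryset A B i)) sums (m A + m B)"
    using radon_empty[OF m] by (rule binaryset_sums)
  ultimately show ?thesis by (simp add: UN_binaryset_eq sums_unique2)
qed

lemma radon_Diff:
  assumes m: "m \<in> radon_measures" and "A \<in> sets borel" "B \<in> sets borel" "B \<subseteq> A"
  shows "m (A - B) = m A - m B"
proof -
  have "m (B \<union> (A - B)) = m B + m (A - B)"
    using assms by (intro radon_Un) auto
  moreover have "B \<union> (A - B) = A" using assms by auto
  ultimately show ?thesis by simp
qed

lemma radon_uminus:
  assumes "m \<in> radon_measures"
  shows "(\<lambda>A. - m A) \<in> radon_measures"
  using assms unfolding radon_measures_def by (auto intro: sums_minus)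

lemma radon_lincomb:
  assumes "m \<in> radon_measures" "m' \<in> radon_measures"
  shows "(\<lambda>A. a * m A + b * m' A) \<in> radon_measures"
  using assms unfolding radon_measures_def by (auto intro!: sums_add sums_mult)

lemma radon_of_measures:
  assumes P: "finite_measure P" "sets P = sets borel" and N: "finite_measure N" "sets N = sets borel"
  shows "(\<lambda>A. measure P A - measure N A) \<in> radon_measures"
proof -
  have "(\<lambda>i. measure P (A i) - measure N (A i)) sums (measure P (\<Union>i. A i) - measure N (\<Union>i. A i))"
    if "range A \<subseteq> sets borel" "disjoint_family A" for A :: "nat \<Rightarrow> torus set"
    using that assms by (intro sums_diff finite_measure.finite_measure_UNION) auto
  moreover have "measure P A = 0" "measure N A = 0" if "A \<notin> sets borel" for A
    using that assms by (simp_all add: measure_notin_sets)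
  ultimately show ?thesis unfolding radon_measures_def by auto
qed

lemma ennreal_add_le: "ennreal (a + b) \<le> ennreal a + ennreal b"
proof -
  have "ennreal (a + b) \<le> ennreal (max 0 a + max 0 b)" by (rule ennreal_leI) simp
  also have "\<dots> = ennreal (max 0 a) + ennreal (max 0 b)" by (rule ennreal_plus) auto
  finally show ?thesis by (simp add: max_def ennreal_neg split: if_splits)
qed

text \<open>The terms may be negative, and \<open>ennreal\<close> truncates them; the partial sums
  are therefore compared through subadditivity of the truncation.\<close>

lemma ennreal_sums_le_suminf:
  assumes "f sums s" "\<And>i. ennreal (f i) \<le> g i"
  shows "ennreal s \<le> (\<Sum>i. g i)"
proof -
  have "ennreal (\<Sum>i<n. f i) \<le> (\<Sum>i<n. g i)" for n
  proof (induction n)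
    case (Suc n)
    have "ennreal (\<Sum>i<Suc n. f i) \<le> ennreal (\<Sum>i<n. f i) + ennreal (f n)"
      by (simp add: ennreal_add_le)
    also have "\<dots> \<le> (\<Sum>i<n. g i) + g n" by (intro add_mono Suc assms)
    finally show ?case by simp
  qed simp
  moreover have "(\<Sum>i<n. g i) \<le> (\<Sum>i. g i)" for n by (rule sum_le_suminf) auto
  ultimately have "ennreal (\<Sum>i<n. f i) \<le> (\<Sum>i. g i)" for n using order_trans by blast
  moreover have "(\<lambda>n. ennreal (\<Sum>i<n. f i)) \<longlonglongrightarrow> ennreal s"
    using assms(1) by (auto simp: sums_def intro: tendsto_ennrealI)
  ultimately show ?thesis by (auto intro: LIMSEQ_le_const2)
qed

lemma sets_pos_part [simp, measurable_cong]: "sets (pos_part m) = sets borel"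
  unfolding pos_part_def using sets.sets_measure_of_eq[of "borel :: torus measure"] by simp

lemma sets_neg_part [simp, measurable_cong]: "sets (neg_part m) = sets borel"
  by (simp add: neg_part_def)

lemma space_pos_part [simp]: "space (pos_part m) = UNIV"
  using sets_eq_imp_space_eq[OF sets_pos_part] by simp

lemma space_neg_part [simp]: "space (neg_part m) = UNIV"
  by (simp add: neg_part_def)

text \<open>Since \<open>pos_part\<close> is built by \<open>measure_of\<close>, the supremum
  formula is available only once it is known to be countably additive. One inequality unites subsets
  of disjoint sets, the other cuts a subset of the union along the \<open>A i\<close>.\<close>

lemma emeasure_pos_part:
  assumes m: "m \<in> radon_measures" and A: "A \<in> sets borel"
  shows "emeasure (pos_part m) A = (SUP B\<in>{B \<in> sets borel. B \<subseteq> A}. ennreal (m B))"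
proof -
  define \<mu> where "\<mu> A = (SUP B\<in>{B \<in> sets borel. B \<subseteq> A}. ennreal (m B))" for A
  have upper: "ennreal (m B) \<le> \<mu> A" if "B \<in> sets borel" "B \<subseteq> A" for A B
    using that unfolding \<mu>_def by (auto intro: SUP_upper)
  have mono: "\<mu> A \<le> \<mu> B" if "A \<subseteq> B" for A B
    using that unfolding \<mu>_def by (intro SUP_subset_mono) auto
  have empty: "\<mu> {} = 0"
  proof -
    have "{B \<in> sets borel. B \<subseteq> ({} :: torus set)} = {{}}" by auto
    then show ?thesis by (simp add: \<mu>_def radon_empty[OF m])
  qed
  have superadd: "\<mu> A + \<mu> B \<le> \<mu> (A \<union> B)" if AB: "A \<inter> B = {}" for A B
  proof -
    have *: "ennreal (m C) + ennreal (m D) \<le> \<mu> (A \<union> B)"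
      if "C \<in> sets borel" "C \<subseteq> A" "D \<in> sets borel" "D \<subseteq> B" for C D
    proof -
      \<comment> \<open>A set of nonpositive value contributes 0 after truncation, so the other set
        alone is a sufficient competitor; uniting the two could lower the value.\<close>
      consider "m C \<le> 0" | "m D \<le> 0" | "0 \<le> m C" "0 \<le> m D" by linarith
      then show ?thesis
      proof cases
        case 1
        then show ?thesis using that upper[of D "A \<union> B"] by (auto simp: ennreal_neg)
      next
        case 2
        then show ?thesis using that upper[of C "A \<union> B"] by (auto simp: ennreal_neg)
      next
        case 3
        then have "ennreal (m C) + ennreal (m D) = ennreal (m (C \<union> D))"
          using that AB by (subst radon_Un[OF m]) (auto simp: ennreal_plus)
        then show ?thesis using that upper[of "C \<union> D" "A \<union> B"] by auto
      qed
    qed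
    have ne: "{C \<in> sets borel. C \<subseteq> X} \<noteq> {}" for X :: "torus set" by auto
    have "ennreal (m C) + \<mu> B \<le> \<mu> (A \<union> B)" if "C \<in> sets borel" "C \<subseteq> A" for C
      unfolding \<mu>_def[of B] using that *
      by (subst ennreal_SUP_add_right[OF ne]) (auto intro!: SUP_least)
    then show ?thesis
      unfolding \<mu>_def[of A] by (subst ennreal_SUP_add_left[OF ne, symmetric]) (auto intro!: SUP_least)
  qed
  have "countably_additive (sets borel) \<mu>"
  proof (rule countably_additiveI)
    fix A :: "nat \<Rightarrow> torus set" assume A: "range A \<subseteq> sets borel" "disjoint_family A"
    have "(\<Sum>i<n. \<mu> (A i)) \<le> \<mu> (\<Union>i<n. A i)" for n
    proof (induction n)
      case (Suc n)
      have "(\<Sum>i<Suc n. \<mu> (A i)) \<le> \<mu> (\<Union>i<n. A i) + \<mu> (A n)"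
        using Suc by (simp add: add_right_mono)
      also have "\<dots> \<le> \<mu> ((\<Union>i<n. A i) \<union> A n)"
      proof (rule superadd)
        have "A i \<inter> A n = {}" if "i < n" for i
          using disjoint_family_onD[OF A(2), of i n] that by simp
        then show "(\<Union>i<n. A i) \<inter> A n = {}" by blast
      qed
      also have "(\<Union>i<n. A i) \<union> A n = (\<Union>i<Suc n. A i)" by (auto simp: lessThan_Suc)
      finally show ?case .
    qed simp
    moreover have "\<mu> (\<Union>i<n. A i) \<le> \<mu> (\<Union>i. A i)" for n by (rule mono) auto
    ultimately have "(\<Sum>i<n. \<mu> (A i)) \<le> \<mu> (\<Union>i. A i)" for n using order_trans by blast
    then have "(\<Sum>i. \<mu> (A i)) \<le> \<mu> (\<Union>i. A i)"
      by (subst suminf_eq_SUP) (auto intro: SUP_least)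
    moreover have "\<mu> (\<Union>i. A i) \<le> (\<Sum>i. \<mu> (A i))"
    proof -
      have "ennreal (m B) \<le> (\<Sum>i. \<mu> (A i))" if B: "B \<in> sets borel" "B \<subseteq> (\<Union>i. A i)" for B
      proof (rule ennreal_sums_le_suminf)
        have "(\<lambda>i. m (B \<inter> A i)) sums m (\<Union>i. B \<inter> A i)"
          using A B by (intro radon_sums[OF m]) (auto simp: disjoint_family_on_def)
        moreover have "(\<Union>i. B \<inter> A i) = B" using B by auto
        ultimately show "(\<lambda>i. m (B \<inter> A i)) sums m B" by simp
        show "ennreal (m (B \<inter> A i)) \<le> \<mu> (A i)" for i using A B by (intro upper) auto
      qed
      then show ?thesis unfolding \<mu>_def[of "\<Union>i. A i"] by (auto intro!: SUP_least)
    qed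
    ultimately show "(\<Sum>i. \<mu> (A i)) = \<mu> (\<Union>i. A i)" by (rule antisym)
  qed
  moreover have "positive (sets borel) \<mu>" by (simp add: positive_def empty)
  moreover have "sigma_algebra UNIV (sets (borel :: torus measure))"
    using sets.sigma_algebra_axioms[of "borel :: torus measure"] by simp
  ultimately have "emeasure (pos_part m) A = \<mu> A"
    unfolding pos_part_def \<mu>_def[symmetric] using A by (intro emeasure_measure_of_sigma)
  then show ?thesis by (simp add: \<mu>_def)
qed

text \<open>If the positive part were infinite, one could pass repeatedly to a smaller set of
  infinite positive part while removing a piece with |m| at least 1. The removed pieces are
  disjoint, so their values would form a convergent series whose terms do not tend to 0.\<close>

lemma finite_pos_part:
  assumes m: "m \<in> radon_measures"
  shows "finite_measure (pos_part m)"
proof (rule finite_measureI, rule notI)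
  let ?P = "pos_part m"
  assume top: "emeasure ?P (space ?P) = \<infinity>"
  let ?Q = "\<lambda>E. E \<in> sets borel \<and> emeasure ?P E = \<infinity>"
  have step: "\<exists>E'. ?Q E' \<and> E' \<subseteq> E \<and> 1 \<le> \<bar>m (E - E')\<bar>" if E: "?Q E" for E
  proof -
    \<comment> \<open>The threshold makes |m| at least 1 on both \<open>B\<close> and
      \<open>E - B\<close>, so whichever of the two keeps infinite positive part may be retained and
      the other removed.\<close>
    have "ennreal (\<bar>m E\<bar> + 1) < (SUP B\<in>{B \<in> sets borel. B \<subseteq> E}. ennreal (m B))"
      using E by (subst emeasure_pos_part[OF m, symmetric]) auto
    then obtain B where B: "B \<in> sets borel" "B \<subseteq> E" "ennreal (\<bar>m E\<bar> + 1) < ennreal (m B)"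
      by (auto simp: less_SUP_iff)
    then have mB: "\<bar>m E\<bar> + 1 < m B" by (subst (asm) ennreal_less_iff) auto
    have "emeasure ?P (B \<union> (E - B)) = emeasure ?P B + emeasure ?P (E - B)"
      using B E by (intro plus_emeasure[symmetric]) auto
    moreover have "B \<union> (E - B) = E" using B by auto
    ultimately have "emeasure ?P B = \<infinity> \<or> emeasure ?P (E - B) = \<infinity>"
      using E by (metis ennreal_add_eq_top infinity_ennreal_def)
    then show ?thesis
    proof
      assume "emeasure ?P B = \<infinity>"
      moreover have "1 \<le> \<bar>m (E - B)\<bar>" using mB B E by (subst radon_Diff[OF m]) auto
      ultimately show ?thesis using B by auto
    next
      assume "emeasure ?P (E - B) = \<infinity>"
      moreover have "E - (E - B) = B" using B by auto
      ultimately show ?thesis using B E mB by (intro exI[of _ "E - B"]) auto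
    qed
  qed
  obtain E where E: "\<And>n. ?Q (E n)" "\<And>n. E (Suc n) \<subseteq> E n \<and> 1 \<le> \<bar>m (E n - E (Suc n))\<bar>"
  proof -
    have "\<exists>E. \<forall>n. ?Q (E n) \<and> (E (Suc n) \<subseteq> E n \<and> 1 \<le> \<bar>m (E n - E (Suc n))\<bar>)"
    proof (rule dependent_nat_choice)
      show "\<exists>E. ?Q E" using top by (intro exI[of _ UNIV]) simp
    qed (use step in blast)
    then show ?thesis using that by blast
  qed
  have dec: "E j \<subseteq> E i" if "i \<le> j" for i j
    using lift_Suc_antimono_le[of E] E(2) that by blast
  have "disjoint_family (\<lambda>n. E n - E (Suc n))"
    unfolding disjoint_family_on_def
  proof (intro ballI impI)
    fix i j :: nat assume "i \<noteq> j"
    then consider "Suc i \<le> j" | "Suc j \<le> i" by linarith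
    then show "(E i - E (Suc i)) \<inter> (E j - E (Suc j)) = {}" using dec by cases blast+
  qed
  then have "(\<lambda>n. m (E n - E (Suc n))) sums m (\<Union>n. E n - E (Suc n))"
    using E(1) by (intro radon_sums[OF m]) auto
  then have "(\<lambda>n. m (E n - E (Suc n))) \<longlonglongrightarrow> 0" by (rule summable_LIMSEQ_zero[OF sums_summable])
  then have "eventually (\<lambda>n. \<bar>m (E n - E (Suc n))\<bar> < 1) sequentially"
    by (auto simp: tendsto_iff dist_real_def dest!: spec[of _ 1])
  then obtain n where "\<bar>m (E n - E (Suc n))\<bar> < 1"
    by (auto simp: eventually_sequentially)
  with E(2)[of n] show False by simp
qed

lemma finite_neg_part: "m \<in> radon_measures \<Longrightarrow> finite_measure (neg_part m)"
  unfolding neg_part_def by (intro finite_pos_part radon_uminus)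

lemma le_measure_pos_part:
  assumes m: "m \<in> radon_measures" and "A \<in> sets borel" "B \<in> sets borel" "B \<subseteq> A"
  shows "m B \<le> measure (pos_part m) A"
proof -
  interpret finite_measure "pos_part m" by (rule finite_pos_part[OF m])
  have "ennreal (m B) \<le> emeasure (pos_part m) A"
    using assms by (subst emeasure_pos_part) (auto intro: SUP_upper)
  then show ?thesis by (simp add: emeasure_eq_measure)
qed

lemma measure_pos_part_le:
  assumes m: "m \<in> radon_measures" and A: "A \<in> sets borel"
    and c: "\<And>B. B \<in> sets borel \<Longrightarrow> B \<subseteq> A \<Longrightarrow> m B \<le> c"
  shows "measure (pos_part m) A \<le> c"
proof -
  interpret finite_measure "pos_part m" by (rule finite_pos_part[OF m])
  have "0 \<le> c" using c[of "{}"] by (simp add: radon_empty[OF m])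
  moreover have "emeasure (pos_part m) A \<le> ennreal c"
    using A c by (subst emeasure_pos_part[OF m A]) (auto intro!: SUP_least ennreal_leI)
  ultimately show ?thesis by (simp add: emeasure_eq_measure)
qed

text \<open>For B inside A, m B = m A - m (A - B), and - m (A - B) is at most the negative part of
  A. Applied to m and to -m this gives both halves of the Jordan decomposition.\<close>

lemma pos_part_le_neg_part:
  assumes m: "m \<in> radon_measures" and A: "A \<in> sets borel"
  shows "measure (pos_part m) A \<le> m A + measure (neg_part m) A"
proof (rule measure_pos_part_le[OF m A])
  fix B assume B: "B \<in> sets borel" "B \<subseteq> A"
  have "- m (A - B) \<le> measure (neg_part m) A"
    unfolding neg_part_def using A B by (intro le_measure_pos_part radon_uminus m) auto
  then show "m B \<le> m A + measure (neg_part m) A"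
    using radon_Diff[OF m A B] by simp
qed

lemma jordan_decomposition:
  assumes m: "m \<in> radon_measures" and A: "A \<in> sets borel"
  shows "m A = measure (pos_part m) A - measure (neg_part m) A"
  using pos_part_le_neg_part[OF m A] pos_part_le_neg_part[OF radon_uminus[OF m] A]
  by (simp add: neg_part_def)

section \<open>Integration and total variation\<close>

lemma finite_borel_integrable:
  fixes f :: "torus \<Rightarrow> real"
  assumes "finite_measure M" "sets M = sets borel" "f \<in> borel_measurable borel" "\<And>x. \<bar>f x\<bar> \<le> B"
  shows "integrable M f"
proof -
  interpret finite_measure M by fact
  show ?thesis
    using assms by (intro integrable_const_bound[of _ B]) (auto simp: measurable_cong_sets[OF assms(2) refl])
qed

lemma continuous_integrable:
  fixes f :: "torus \<Rightarrow> real"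
  assumes "finite_measure M" "sets M = sets borel" "continuous_on UNIV f"
  shows "integrable M f"
  using continuous_bounded_torus[OF assms(3)]
    finite_borel_integrable[OF assms(1,2) borel_measurable_continuous_onI[OF assms(3)]] by blast

text \<open>The approximating sums do not depend on the measure, so relations between the values of
  measures on sets carry over to integrals.\<close>

lemma integral_limit_of_sums:
  fixes f :: "torus \<Rightarrow> real"
  assumes f: "f \<in> borel_measurable borel" "\<And>x. \<bar>f x\<bar> \<le> B"
  obtains F :: "nat \<Rightarrow> torus \<Rightarrow> real"
  where "\<And>k. finite (range (F k))" "\<And>k y. F k -` {y} \<in> sets borel"
    and "\<And>M. finite_measure M \<Longrightarrow> sets M = sets borel \<Longrightarrow>
      (\<lambda>k. \<Sum>y\<in>range (F k). y * measure M (F k -` {y})) \<longlonglongrightarrow> integral\<^sup>L M f"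
proof -
  obtain F where F: "\<And>i. simple_function borel (F i)" "\<And>x. (\<lambda>i. F i x) \<longlonglongrightarrow> f x"
      "\<And>i x. dist (F i x) 0 \<le> 2 * dist (f x) 0"
    using borel_measurable_implies_sequence_metric[OF f(1), of 0] by auto
  have fin: "finite (range (F k))" for k using F(1)[of k] by (simp add: simple_function_def)
  have meas: "F k -` {y} \<in> sets borel" for k y
  proof -
    have "F k \<in> borel_measurable borel" by (rule borel_measurable_simple_function[OF F(1)])
    then show ?thesis using measurable_sets[of "F k" borel borel "{y}"] by simp
  qed
  have "(\<lambda>k. \<Sum>y\<in>range (F k). y * measure M (F k -` {y})) \<longlonglongrightarrow> integral\<^sup>L M f"
    if M: "finite_measure M" "sets M = sets borel" for M
  proof -
    interpret finite_measure M by fact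
    have spM: "space M = UNIV" using sets_eq_imp_space_eq[OF M(2)] by simp
    have "integral\<^sup>L M (F k) = (\<Sum>y\<in>range (F k). y * measure M (F k -` {y}))" for k
    proof -
      have "F k x = (\<Sum>y\<in>range (F k). y * indicator (F k -` {y}) x)" for x
        by (rule trans[OF simple_function_indicator_representation_banach[OF F(1)]])
          (simp_all add: mult.commute)
      then have "integral\<^sup>L M (F k) = (\<integral>x. (\<Sum>y\<in>range (F k). y * indicator (F k -` {y}) x) \<partial>M)"
        by (rule Bochner_Integration.integral_cong[OF refl])
      also have "\<dots> = (\<Sum>y\<in>range (F k). \<integral>x. y * indicator (F k -` {y}) x \<partial>M)"
        by (intro Bochner_Integration.integral_sum integrable_mult_right integrable_real_indicator)
          (simp_all add: M(2) meas emeasure_eq_measure)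
      finally show ?thesis by (simp add: M(2) meas spM)
    qed
    moreover have "(\<lambda>k. integral\<^sup>L M (F k)) \<longlonglongrightarrow> integral\<^sup>L M f"
    proof (rule integral_dominated_convergence[where w="\<lambda>_. 2 * B"])
      show "f \<in> borel_measurable M" "F k \<in> borel_measurable M" for k
        unfolding measurable_cong_sets[OF M(2) refl]
        by (rule f borel_measurable_simple_function F)+
      show "AE x in M. norm (F k x) \<le> 2 * B" for k
      proof (rule AE_I2)
        fix x show "norm (F k x) \<le> 2 * B" using F(3)[of k x] f(2)[of x] by simp
      qed
    qed (use F(2) in auto)
    ultimately show ?thesis by simp
  qed
  with fin meas show ?thesis using that by blast
qed

lemma radon_integral_limit_of_sums:
  assumes f: "f \<in> borel_measurable borel" "\<And>x. \<bar>f x\<bar> \<le> B"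
  obtains F :: "nat \<Rightarrow> torus \<Rightarrow> real"
  where "\<And>m P N. finite_measure P \<Longrightarrow> sets P = sets borel \<Longrightarrow> finite_measure N \<Longrightarrow>
      sets N = sets borel \<Longrightarrow> (\<And>A. A \<in> sets borel \<Longrightarrow> m A = measure P A - measure N A) \<Longrightarrow>
      (\<lambda>k. \<Sum>y\<in>range (F k). y * m (F k -` {y})) \<longlonglongrightarrow> integral\<^sup>L P f - integral\<^sup>L N f"
proof -
  obtain F :: "nat \<Rightarrow> torus \<Rightarrow> real" where F: "\<And>k. finite (range (F k))" "\<And>k y. F k -` {y} \<in> sets borel"
    "\<And>M. finite_measure M \<Longrightarrow> sets M = sets borel \<Longrightarrow>
      (\<lambda>k. \<Sum>y\<in>range (F k). y * measure M (F k -` {y})) \<longlonglongrightarrow> integral\<^sup>L M f"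
    using integral_limit_of_sums[OF f] by blast
  show ?thesis
  proof (rule that[of F])
    fix m :: "torus set \<Rightarrow> real" and P N :: "torus measure"
    assume PN: "finite_measure P" "sets P = sets borel" "finite_measure N"
      "sets N = sets borel" "\<And>A. A \<in> sets borel \<Longrightarrow> m A = measure P A - measure N A"
    show "(\<lambda>k. \<Sum>y\<in>range (F k). y * m (F k -` {y})) \<longlonglongrightarrow> integral\<^sup>L P f - integral\<^sup>L N f"
      using tendsto_diff[OF F(3)[OF PN(1,2)] F(3)[OF PN(3,4)]]
      by (simp add: PN(5)[OF F(2)] right_diff_distrib sum_subtractf)
  qed
qed

lemma signed_integral_eq:
  assumes m: "m \<in> radon_measures"
    and PN: "finite_measure P" "sets P = sets borel" "finite_measure N" "sets N = sets borel"
      "\<And>A. A \<in> sets borel \<Longrightarrow> m A = measure P A - measure N A"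
    and f: "f \<in> borel_measurable borel" "\<And>x. \<bar>f x\<bar> \<le> B"
  shows "signed_integral m f = integral\<^sup>L P f - integral\<^sup>L N f"
proof -
  obtain F :: "nat \<Rightarrow> torus \<Rightarrow> real"
  where F: "\<And>m P N. finite_measure P \<Longrightarrow> sets P = sets borel \<Longrightarrow> finite_measure N \<Longrightarrow>
      sets N = sets borel \<Longrightarrow> (\<And>A. A \<in> sets borel \<Longrightarrow> m A = measure P A - measure N A) \<Longrightarrow>
      (\<lambda>k. \<Sum>y\<in>range (F k). y * m (F k -` {y})) \<longlonglongrightarrow> integral\<^sup>L P f - integral\<^sup>L N f"
    using radon_integral_limit_of_sums[OF f] by blast
  show ?thesis
    unfolding signed_integral_def
    using F[OF finite_pos_part[OF m] sets_pos_part finite_neg_part[OF m] sets_neg_part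
        jordan_decomposition[OF m]] F[OF PN] by (rule LIMSEQ_unique)
qed

text \<open>The Jordan parts of a combination are in general not combinations of Jordan parts, so
  linearity is read off the approximating sums.\<close>

lemma signed_integral_lincomb:
  assumes m: "m \<in> radon_measures" "m' \<in> radon_measures"
    and f: "f \<in> borel_measurable borel" "\<And>x. \<bar>f x\<bar> \<le> B"
  shows "signed_integral (\<lambda>A. a * m A + b * m' A) f = a * signed_integral m f + b * signed_integral m' f"
proof -
  obtain F :: "nat \<Rightarrow> torus \<Rightarrow> real"
  where F: "\<And>m P N. finite_measure P \<Longrightarrow> sets P = sets borel \<Longrightarrow> finite_measure N \<Longrightarrow>
      sets N = sets borel \<Longrightarrow> (\<And>A. A \<in> sets borel \<Longrightarrow> m A = measure P A - measure N A) \<Longrightarrow>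
      (\<lambda>k. \<Sum>y\<in>range (F k). y * m (F k -` {y})) \<longlonglongrightarrow> integral\<^sup>L P f - integral\<^sup>L N f"
    using radon_integral_limit_of_sums[OF f] by blast
  have lim: "(\<lambda>k. \<Sum>y\<in>range (F k). y * m (F k -` {y})) \<longlonglongrightarrow> signed_integral m f"
    if "m \<in> radon_measures" for m
    unfolding signed_integral_def
    by (rule F[of _ _ m]) (auto intro: finite_pos_part finite_neg_part that jordan_decomposition)
  have "(\<lambda>k. \<Sum>y\<in>range (F k). y * (a * m (F k -` {y}) + b * m' (F k -` {y})))
      \<longlonglongrightarrow> a * signed_integral m f + b * signed_integral m' f"
    using tendsto_add[OF tendsto_mult_left[OF lim[OF m(1)], of a] tendsto_mult_left[OF lim[OF m(2)], of b]]
    by (simp add: sum_distrib_left sum.distrib algebra_simps)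
  with lim[OF radon_lincomb[OF m, of a b]] show ?thesis by (rule LIMSEQ_unique)
qed

lemma signed_integral_lincomb_continuous:
  assumes "m \<in> radon_measures" "m' \<in> radon_measures" "continuous_on UNIV f"
  shows "signed_integral (\<lambda>A. a * m A + b * m' A) f = a * signed_integral m f + b * signed_integral m' f"
  using signed_integral_lincomb[OF assms(1,2) borel_measurable_continuous_onI[OF assms(3)]]
    continuous_bounded_torus[OF assms(3)] by blast

text \<open>The total variation seen from the Jordan decomposition, to be identified with the dual
  norm \<open>tv_norm\<close>.\<close>

definition total_mass :: "(torus set \<Rightarrow> real) \<Rightarrow> real"
  where "total_mass m = measure (pos_part m) UNIV + measure (neg_part m) UNIV"

lemma abs_integral_le_measure:
  fixes f :: "torus \<Rightarrow> real"
  assumes M: "finite_measure M" "sets M = sets borel"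
    and f: "f \<in> borel_measurable borel" "\<And>x. \<bar>f x\<bar> \<le> B"
  shows "\<bar>integral\<^sup>L M f\<bar> \<le> B * measure M UNIV"
proof -
  interpret finite_measure M by fact
  have int: "integrable M f" using finite_borel_integrable[OF M f] .
  have "\<bar>integral\<^sup>L M f\<bar> \<le> (\<integral>x. \<bar>f x\<bar> \<partial>M)" by (rule integral_abs_bound)
  also have "\<dots> \<le> (\<integral>x. B \<partial>M)" using f(2) int by (intro integral_mono) auto
  also have "\<dots> = B * measure M UNIV" using sets_eq_imp_space_eq[OF M(2)] by simp
  finally show ?thesis .
qed

lemma abs_signed_integral_le:
  assumes m: "m \<in> radon_measures" and f: "f \<in> borel_measurable borel" "\<And>x. \<bar>f x\<bar> \<le> B"
  shows "\<bar>signed_integral m f\<bar> \<le> B * total_mass m"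
  using abs_integral_le_measure[OF finite_pos_part[OF m] sets_pos_part f]
    abs_integral_le_measure[OF finite_neg_part[OF m] sets_neg_part f]
  unfolding signed_integral_def total_mass_def by (simp add: algebra_simps)

lemma signed_integral_le_tv_norm:
  assumes m: "m \<in> radon_measures" and f: "continuous_on UNIV f" "\<And>x. \<bar>f x\<bar> \<le> 1"
  shows "signed_integral m f \<le> tv_norm m"
proof -
  \<comment> \<open>A real supremum dominates its members only when the set is bounded above; the
    total mass is the bound.\<close>
  have "signed_integral m \<psi> \<le> total_mass m" if "continuous_on UNIV \<psi>" "sup_norm \<psi> \<le> 1" for \<psi>
    using abs_signed_integral_le[OF m, of \<psi> 1] that
    by (auto simp: sup_norm_le_iff borel_measurable_continuous_onI)
  then show ?thesis
    unfolding tv_norm_def using f by (intro cSUP_upper bdd_aboveI2) (auto simp: sup_norm_le_iff)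
qed

lemma tv_norm_leI:
  assumes "\<And>\<psi>. continuous_on UNIV \<psi> \<Longrightarrow> (\<And>x. \<bar>\<psi> x\<bar> \<le> 1) \<Longrightarrow> signed_integral m \<psi> \<le> c"
  shows "tv_norm m \<le> c"
  unfolding tv_norm_def
proof (rule cSUP_least)
  have "(\<lambda>_. 0) \<in> {\<psi>. continuous_on UNIV \<psi> \<and> sup_norm \<psi> \<le> 1}" by (simp add: sup_norm_le_iff)
  then show "{\<psi>. continuous_on UNIV \<psi> \<and> sup_norm \<psi> \<le> 1} \<noteq> {}" by blast
qed (use assms in \<open>auto simp: sup_norm_le_iff\<close>)

lemma tv_norm_le_total_mass:
  assumes m: "m \<in> radon_measures"
  shows "tv_norm m \<le> total_mass m"
  using abs_signed_integral_le[OF m, of _ 1]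
  by (intro tv_norm_leI) (auto simp: borel_measurable_continuous_onI abs_le_iff)

text \<open>The left side is the integral of the function equal to 1 on \<open>K\<close> and -1
  elsewhere, which is a pointwise limit of continuous functions bounded by 1.\<close>

lemma closed_set_le_tv_norm:
  assumes m: "m \<in> radon_measures" and K: "closed K"
  shows "2 * m K - m UNIV \<le> tv_norm m"
\<comment> \<open>By convention \<open>infdist\<close> to the empty set is 0, which would make every
  approximant equal to 1 instead of -1.\<close>
proof (cases "K = {}")
  case True
  have "signed_integral m (\<lambda>_. -1) \<le> tv_norm m" by (rule signed_integral_le_tv_norm[OF m]) auto
  moreover have "signed_integral m (\<lambda>_. -1) = - m UNIV"
    using jordan_decomposition[OF m, of UNIV] by (simp add: signed_integral_def)
  ultimately show ?thesis using True radon_empty[OF m] by simp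
next
  case False
  \<comment> \<open>Equal to 1 on \<open>K\<close> and to -1 at distance at least 1/n from
    it.\<close>
  define \<psi> where "\<psi> n x = 1 - 2 * min 1 (real n * infdist x K)" for n x
  have cont: "continuous_on UNIV (\<psi> n)" for n unfolding \<psi>_def by (intro continuous_intros)
  have bound: "\<bar>\<psi> n x\<bar> \<le> 1" for n x using infdist_nonneg[of x K] by (auto simp: \<psi>_def min_def abs_le_iff)
  have lim: "(\<lambda>n. \<psi> n x) \<longlonglongrightarrow> 2 * indicator K x - 1" for x
  proof (cases "x \<in> K")
    case True
    then show ?thesis by (simp add: \<psi>_def)
  next
    case x: False
    then have pos: "0 < infdist x K" using K False infdist_pos_not_in_closed by blast
    obtain n0 :: nat where n0: "1 / infdist x K \<le> real n0" using real_arch_simple by blast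
    have "\<psi> n x = -1" if "n0 \<le> n" for n
    proof -
      have "1 / infdist x K \<le> real n" using that n0 by linarith
      then have "1 \<le> real n * infdist x K" using pos by (simp add: field_simps)
      then show ?thesis by (simp add: \<psi>_def)
    qed
    then have "eventually (\<lambda>n. \<psi> n x = -1) sequentially" by (auto simp: eventually_sequentially)
    then show ?thesis using x by (simp add: tendsto_eventually)
  qed
  have lim_int: "(\<lambda>n. integral\<^sup>L M (\<psi> n)) \<longlonglongrightarrow> 2 * measure M K - measure M UNIV"
    if M: "finite_measure M" "sets M = sets borel" for M
  proof -
    interpret finite_measure M by fact
    have sp: "space M = UNIV" using sets_eq_imp_space_eq[OF M(2)] by simp
    have KM: "K \<in> sets M" using K M by simp
    have "(\<lambda>n. integral\<^sup>L M (\<psi> n)) \<longlonglongrightarrow> (\<integral>x. 2 * indicator K x - 1 \<partial>M)"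
      by (rule integral_dominated_convergence[where w="\<lambda>_. 1"])
        (use bound lim K KM M cont in \<open>auto simp: measurable_cong_sets[OF M(2) refl] borel_measurable_continuous_onI\<close>)
    also have "(\<integral>x. 2 * indicator K x - 1 \<partial>M) = 2 * measure M K - measure M UNIV"
      using KM by (subst Bochner_Integration.integral_diff) (auto simp: sp emeasure_eq_measure)
    finally show ?thesis .
  qed
  have "(\<lambda>n. signed_integral m (\<psi> n)) \<longlonglongrightarrow> 2 * m K - m UNIV"
    unfolding signed_integral_def
    using tendsto_diff[OF lim_int[OF finite_pos_part[OF m]] lim_int[OF finite_neg_part[OF m]]] K
    by (simp add: jordan_decomposition[OF m] algebra_simps)
  moreover have "signed_integral m (\<psi> n) \<le> tv_norm m" for n
    using signed_integral_le_tv_norm[OF m cont bound] .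
  ultimately show ?thesis by (auto intro: LIMSEQ_le_const2)
qed

text \<open>Inner regularity extends the bound for closed sets to all Borel sets B in the form m B
  \<le> (\<open>tv_norm m\<close> + m UNIV) / 2. Taking the supremum over B bounds the mass of the
  positive part, and twice that mass minus m UNIV is the total mass.\<close>

lemma tv_norm_eq_total_mass:
  assumes m: "m \<in> radon_measures"
  shows "tv_norm m = total_mass m"
proof (rule antisym[OF tv_norm_le_total_mass[OF m]])
  interpret P: finite_measure "pos_part m" by (rule finite_pos_part[OF m])
  interpret N: finite_measure "neg_part m" by (rule finite_neg_part[OF m])
  have "m B \<le> (tv_norm m + m UNIV) / 2" if B: "B \<in> sets borel" for B
  proof (rule field_le_epsilon)
    fix e :: real assume e: "0 < e"
    have "\<exists>K. compact K \<and> K \<subseteq> B \<and> measure (pos_part m) B - e < measure (pos_part m) K"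
    proof (cases "measure (pos_part m) B - e < 0")
      case True
      then show ?thesis by (intro exI[of _ "{}"]) auto
    next
      case False
      have "ennreal (measure (pos_part m) B - e) < emeasure (pos_part m) B"
        using False e by (simp add: P.emeasure_eq_measure ennreal_less_iff)
      also have "emeasure (pos_part m) B = (SUP K\<in>{K. K \<subseteq> B \<and> compact K}. emeasure (pos_part m) K)"
        using B by (intro inner_regular) (auto simp: P.emeasure_eq_measure)
      finally show ?thesis
        using False by (auto simp: less_SUP_iff P.emeasure_eq_measure ennreal_less_iff)
    qed
    then obtain K where K: "compact K" "K \<subseteq> B" "measure (pos_part m) B - e < measure (pos_part m) K"
      by blast
    \<comment> \<open>Passing from \<open>B\<close> to \<open>K\<close> loses at most
      \<open>e\<close> of the positive part and cannot increase the negative part, so m drops by at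
      most \<open>e\<close>.\<close>
    have "measure (neg_part m) K \<le> measure (neg_part m) B" using K B by (intro N.finite_measure_mono) auto
    then have "m B - e \<le> m K"
      using K B compact_imp_closed[OF K(1)] by (simp add: jordan_decomposition[OF m])
    with closed_set_le_tv_norm[OF m compact_imp_closed[OF K(1)]]
    show "m B \<le> (tv_norm m + m UNIV) / 2 + e" by (simp add: field_simps)
  qed
  then have "measure (pos_part m) UNIV \<le> (tv_norm m + m UNIV) / 2"
    by (intro measure_pos_part_le[OF m]) auto
  then show "total_mass m \<le> tv_norm m"
    using jordan_decomposition[OF m, of UNIV] by (simp add: total_mass_def)
qed

lemma tv_norm_lincomb:
  assumes m: "m \<in> radon_measures" "m' \<in> radon_measures" and ab: "0 \<le> a" "0 \<le> b"
  shows "tv_norm (\<lambda>A. a * m A + b * m' A) \<le> a * tv_norm m + b * tv_norm m'"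
  using m ab by (intro tv_norm_leI)
    (auto simp: signed_integral_lincomb_continuous intro!: add_mono mult_left_mono signed_integral_le_tv_norm)

text \<open>Dirac masses of signed weight: the competitors that turn optimality among measures into
  pointwise bounds on \<open>Phi_adj\<close>.\<close>

definition point_mass :: "torus \<Rightarrow> real \<Rightarrow> torus set \<Rightarrow> real"
  where "point_mass t c A = c * measure (return borel t) A"

lemma return_torus: "finite_measure (return borel (t :: torus))" "sets (return borel t) = sets borel"
  using prob_space_return[of t borel] by (auto simp: prob_space_def)

lemma finite_measure_null: "finite_measure (null_measure M)"
  by (rule finite_measureI) simp

lemma radon_return: "(\<lambda>A. measure (return borel t) A) \<in> radon_measures"
  using radon_of_measures[OF return_torus, of "null_measure borel" t]
  by (simp add: finite_measure_null)

lemma radon_point_mass: "point_mass t c \<in> radon_measures"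
  using radon_lincomb[OF radon_return radon_return, of c t 0 t] by (simp add: point_mass_def[abs_def])

lemma signed_integral_point_mass:
  assumes f: "continuous_on UNIV f"
  shows "signed_integral (point_mass t c) f = c * f t"
proof -
  obtain B where B: "\<And>x. \<bar>f x\<bar> \<le> B" using continuous_bounded_torus[OF f] by blast
  have fm: "f \<in> borel_measurable borel" using f by (rule borel_measurable_continuous_onI)
  have "signed_integral (\<lambda>A. measure (return borel t) A) f
      = integral\<^sup>L (return borel t) f - integral\<^sup>L (null_measure borel) f"
    by (rule signed_integral_eq[OF radon_return return_torus _ _ _ fm B])
      (auto simp: finite_measure_null)
  also have "\<dots> = f t" using fm by (simp add: integral_return)
  finally show ?thesis
    using signed_integral_lincomb[OF radon_return radon_return fm B, of c t 0 t]
    by (simp add: point_mass_def[abs_def])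
qed

lemma tv_norm_point_mass: "tv_norm (point_mass t c) \<le> \<bar>c\<bar>"
proof (rule tv_norm_leI)
  fix \<psi> :: "torus \<Rightarrow> real" assume \<psi>: "continuous_on UNIV \<psi>" "\<And>x. \<bar>\<psi> x\<bar> \<le> 1"
  have "c * \<psi> t \<le> \<bar>c\<bar> * \<bar>\<psi> t\<bar>" by (metis abs_ge_self abs_mult)
  also have "\<dots> \<le> \<bar>c\<bar> * 1" using \<psi>(2) by (intro mult_left_mono) auto
  finally show "signed_integral (point_mass t c) \<psi> \<le> \<bar>c\<bar>" by (simp add: signed_integral_point_mass[OF \<psi>(1)])
qed

section \<open>Weak-* compactness\<close>

text \<open>The measures are normalised and pushed to [0, 1) by the section, where they are tight; a
  weak limit on the line is folded back by \<open>to_torus\<close>. The discontinuity of the section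
  does no harm, because the integrands tested on the line are f composed with
  \<open>to_torus\<close>, which are continuous.\<close>

lemma finite_measures_sequentially_compact:
  fixes P :: "nat \<Rightarrow> torus measure"
  assumes P: "\<And>n. finite_measure (P n)" "\<And>n. sets (P n) = sets borel"
    and c: "\<And>n. measure (P n) UNIV \<le> c"
  obtains r Q where "strict_mono (r :: nat \<Rightarrow> nat)" "finite_measure Q" "sets Q = sets borel"
    "\<And>f :: torus \<Rightarrow> real. continuous_on UNIV f \<Longrightarrow> (\<lambda>n. integral\<^sup>L (P (r n)) f) \<longlonglongrightarrow> integral\<^sup>L Q f"
proof -
  define w where "w n = measure (P n) UNIV" for n
  have w: "w n \<in> {0..c}" for n using c by (simp add: w_def)
  have sp: "space (P n) = UNIV" for n using sets_eq_imp_space_eq[OF P(2)] by simp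
  have em: "emeasure (P n) A = ennreal (measure (P n) A)" for n A
    using P(1) by (simp add: finite_measure.emeasure_eq_measure)
  have sec: "torus_section \<in> measurable (P n) borel" for n
    by (simp add: measurable_cong_sets[OF P(2) refl] measurable_torus_section)
  obtain l s where ls: "strict_mono s" "l \<in> {0..c}" "(\<lambda>n. w (s n)) \<longlonglongrightarrow> l"
    using compact_imp_seq_compact[OF compact_Icc, of 0 c] w unfolding seq_compact_def comp_def by metis
  \<comment> \<open>A measure of mass 0 cannot be normalised; the point mass is a placeholder which
    the factor \<open>w n\<close> erases in \<open>int_\<mu>\<close>.\<close>
  define \<mu> where "\<mu> n = (if w n = 0 then return borel 0
    else distr (density (P n) (\<lambda>_. ennreal (1 / w n))) borel torus_section)" for n
  have prob: "prob_space (\<mu> n)" for n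
  proof (cases "w n = 0")
    case True
    then show ?thesis by (simp add: \<mu>_def prob_space_return)
  next
    case False
    then have "0 < w n" using w[of n] by simp
    have "prob_space (density (P n) (\<lambda>_. ennreal (1 / w n)))"
    proof (rule prob_spaceI)
      have "emeasure (density (P n) (\<lambda>_. ennreal (1 / w n))) UNIV = ennreal (1 / w n) * ennreal (w n)"
        by (simp add: emeasure_density_const P(2) em w_def)
      also have "\<dots> = 1" using \<open>0 < w n\<close> by (simp flip: ennreal_mult)
      finally show "emeasure (density (P n) (\<lambda>_. ennreal (1 / w n)))
        (space (density (P n) (\<lambda>_. ennreal (1 / w n)))) = 1" by (simp add: sp)
    qed
    then show ?thesis
      using False sec by (simp add: \<mu>_def prob_space.prob_space_distr)
  qed
  have sets_\<mu>: "sets (\<mu> n) = sets borel" for n by (simp add: \<mu>_def)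
  have rd: "real_distribution (\<mu> n)" for n
    using prob sets_\<mu> by (simp add: real_distribution_def real_distribution_axioms_def)
  have int_\<mu>: "integral\<^sup>L (P n) f = w n * (\<integral>u. f (to_torus u) \<partial>\<mu> n)" if f: "continuous_on UNIV f"
    for n and f :: "torus \<Rightarrow> real"
  proof (cases "w n = 0")
    case True
    obtain B where B: "\<And>x. \<bar>f x\<bar> \<le> B" using continuous_bounded_torus[OF f] by blast
    have "\<bar>integral\<^sup>L (P n) f\<bar> \<le> B * w n"
      using abs_integral_le_measure[OF P(1,2) borel_measurable_continuous_onI[OF f] B] by (simp add: w_def)
    then show ?thesis using True by simp
  next
    case False
    have fm: "f \<in> borel_measurable borel" using f by (rule borel_measurable_continuous_onI)
    then have fm': "(\<lambda>u. f (to_torus u)) \<in> borel_measurable borel" by measurable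
    have "(\<integral>u. f (to_torus u) \<partial>\<mu> n)
        = (\<integral>x. f x \<partial>density (P n) (\<lambda>_. ennreal (1 / w n)))"
      using False sec by (simp add: \<mu>_def integral_distr fm')
    also have "\<dots> = (\<integral>x. (1 / w n) *\<^sub>R f x \<partial>P n)"
      using w[of n] fm by (intro integral_density) (auto simp: measurable_cong_sets[OF P(2) refl])
    finally show ?thesis using False by simp
  qed
  have "tight \<mu>"
    unfolding tight_def
  proof (intro conjI allI impI)
    fix e :: real assume "0 < e"
    \<comment> \<open>Tightness is stated with intervals open on the left, so the left end has to
      lie strictly below 0.\<close>
    have "measure (\<mu> n) {-1<..1} = 1" for n
    proof (cases "w n = 0")
      case True
      then show ?thesis by (simp add: \<mu>_def measure_return)
    next
      case False
      have "torus_section -` {-1<..1} = UNIV"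
      proof (intro set_eqI iffI)
        fix x show "x \<in> torus_section -` {-1<..1}" using torus_section_bounds[of x] by simp
      qed simp
      then have "measure (\<mu> n) {-1<..1} = measure (\<mu> n) UNIV"
        using False sec by (simp add: \<mu>_def measure_distr sp)
      also have "\<dots> = 1"
        using prob_space.prob_space[OF prob] sets_eq_imp_space_eq[OF sets_\<mu>] by simp
      finally show ?thesis .
    qed
    then show "\<exists>a b. a < b \<and> (\<forall>n. 1 - e < measure (\<mu> n) {a<..b})"
      using \<open>0 < e\<close> by (intro exI[of _ "-1"] exI[of _ 1]) auto
  qed (rule rd)
  from tight_imp_convergent_subsubsequence[OF this ls(1)] obtain r M where
    r: "strict_mono r" "real_distribution M" "weak_conv_m (\<mu> \<circ> s \<circ> r) M" by blast
  interpret M: real_distribution M by fact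
  \<comment> \<open>The masses converge to \<open>l\<close> separately. Mass that accumulates at 1
    on the line lands on the class of 0, as it should.\<close>
  define Q where "Q = density (distr M borel to_torus) (\<lambda>_. ennreal l)"
  have tm: "to_torus \<in> measurable M borel" by measurable
  show ?thesis
  proof (rule that[of "s \<circ> r" Q])
    show "strict_mono (s \<circ> r)" using ls(1) r(1) by (rule strict_mono_o)
    show "sets Q = sets borel" by (simp add: Q_def)
    show "finite_measure Q"
    proof (rule finite_measureI)
      show "emeasure Q (space Q) \<noteq> \<infinity>"
        using M.emeasure_space_1
        by (simp add: Q_def emeasure_density_const emeasure_distr[OF tm] ennreal_mult_eq_top_iff)
    qed
    fix f :: "torus \<Rightarrow> real" assume f: "continuous_on UNIV f"
    obtain B where B: "\<And>x. \<bar>f x\<bar> \<le> B" using continuous_bounded_torus[OF f] by blast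
    have fm: "f \<in> borel_measurable borel" using f by (rule borel_measurable_continuous_onI)
    have "(\<lambda>n. \<integral>u. f (to_torus u) \<partial>((\<mu> \<circ> s \<circ> r) n)) \<longlonglongrightarrow> (\<integral>u. f (to_torus u) \<partial>M)"
    proof (rule weak_conv_imp_integral_bdd_continuous_conv[OF _ r(2,3)])
      show "real_distribution ((\<mu> \<circ> s \<circ> r) n)" for n by (simp add: rd)
      have "continuous_on UNIV (\<lambda>u. f (to_torus u))"
        using continuous_on_compose2[OF f continuous_on_to_torus] by simp
      then show "isCont (\<lambda>u. f (to_torus u)) x" for x
        by (simp add: continuous_on_eq_continuous_at)
      show "norm (f (to_torus x)) \<le> B" for x using B by simp
    qed
    then have "(\<lambda>n. w (s (r n)) * (\<integral>u. f (to_torus u) \<partial>\<mu> (s (r n)))) \<longlonglongrightarrow> l * (\<integral>u. f (to_torus u) \<partial>M)"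
      using tendsto_mult[OF LIMSEQ_subseq_LIMSEQ[OF ls(3) r(1)]] by (simp add: comp_def)
    moreover have "integral\<^sup>L Q f = l * (\<integral>u. f (to_torus u) \<partial>M)"
    proof -
      have "integral\<^sup>L Q f = (\<integral>x. l *\<^sub>R f x \<partial>distr M borel to_torus)"
        unfolding Q_def using ls(2) fm by (intro integral_density) auto
      then show ?thesis using fm by (simp add: integral_distr[OF tm])
    qed
    ultimately show "(\<lambda>n. integral\<^sup>L (P ((s \<circ> r) n)) f) \<longlonglongrightarrow> integral\<^sup>L Q f"
      by (simp add: int_\<mu>[OF f])
  qed
qed

text \<open>The two Jordan parts are extracted one after the other. The bound on the limit is weak-*
  lower semicontinuity of the norm: it passes to the limit for each test function.\<close>

lemma radon_sequentially_compact:
  assumes m: "\<And>n. m n \<in> radon_measures" "\<And>n. tv_norm (m n) \<le> c"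
  obtains r m' where "strict_mono (r :: nat \<Rightarrow> nat)" "m' \<in> radon_measures" "tv_norm m' \<le> c"
    "\<And>f. continuous_on UNIV f \<Longrightarrow> (\<lambda>n. signed_integral (m (r n)) f) \<longlonglongrightarrow> signed_integral m' f"
proof -
  have mass: "measure (pos_part (m n)) UNIV \<le> c" "measure (neg_part (m n)) UNIV \<le> c" for n
    using m(2)[of n] tv_norm_eq_total_mass[OF m(1)[of n]]
      measure_nonneg[of "pos_part (m n)" UNIV] measure_nonneg[of "neg_part (m n)" UNIV]
    unfolding total_mass_def by linarith+
  obtain r P where P: "strict_mono (r :: nat \<Rightarrow> nat)" "finite_measure P" "sets P = sets borel"
    "\<And>f :: torus \<Rightarrow> real. continuous_on UNIV f \<Longrightarrow> (\<lambda>n. integral\<^sup>L (pos_part (m (r n))) f) \<longlonglongrightarrow> integral\<^sup>L P f"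
    by (rule finite_measures_sequentially_compact[where P="\<lambda>n. pos_part (m n)" and c=c])
      (use mass(1) m(1) in \<open>simp_all add: finite_pos_part\<close>)
  obtain s N where N: "strict_mono (s :: nat \<Rightarrow> nat)" "finite_measure N" "sets N = sets borel"
    "\<And>f :: torus \<Rightarrow> real. continuous_on UNIV f \<Longrightarrow> (\<lambda>n. integral\<^sup>L (neg_part (m (r (s n)))) f) \<longlonglongrightarrow> integral\<^sup>L N f"
    by (rule finite_measures_sequentially_compact[where P="\<lambda>n. neg_part (m (r n))" and c=c])
      (use mass(2) m(1) in \<open>simp_all add: finite_neg_part\<close>)
  define m' where "m' A = measure P A - measure N A" for A
  have m': "m' \<in> radon_measures"
    unfolding m'_def using radon_of_measures[OF P(2,3) N(2,3)] .
  have lim: "(\<lambda>n. signed_integral (m (r (s n))) f) \<longlonglongrightarrow> signed_integral m' f" if f: "continuous_on UNIV f" for f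
  proof -
    obtain B where B: "\<And>x. \<bar>f x\<bar> \<le> B" using continuous_bounded_torus[OF f] by blast
    have "signed_integral m' f = integral\<^sup>L P f - integral\<^sup>L N f"
      by (rule signed_integral_eq[OF m' P(2,3) N(2,3) _ borel_measurable_continuous_onI[OF f] B])
        (simp add: m'_def)
    then show ?thesis
      using tendsto_diff[OF LIMSEQ_subseq_LIMSEQ[OF P(4)[OF f] N(1)] N(4)[OF f]]
      by (simp add: signed_integral_def comp_def)
  qed
  have "tv_norm m' \<le> c"
  proof (rule tv_norm_leI)
    fix \<psi> :: "torus \<Rightarrow> real" assume \<psi>: "continuous_on UNIV \<psi>" "\<And>x. \<bar>\<psi> x\<bar> \<le> 1"
    have "signed_integral (m (r (s n))) \<psi> \<le> c" for n
      using signed_integral_le_tv_norm[OF m(1) \<psi>] m(2) order_trans by blast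
    then show "signed_integral m' \<psi> \<le> c" using lim[OF \<psi>(1)] by (auto intro: LIMSEQ_le_const2)
  qed
  with m' lim strict_mono_o[OF P(1) N(1)] show ?thesis using that[of "r \<circ> s" m'] by (simp add: comp_def)
qed

section \<open>Square-integrable functions and the operator\<close>

interpretation haar: prob_space haar
  by (rule prob_space_haar)

lemma borel_measurable_haar: "f \<in> borel_measurable haar \<longleftrightarrow> f \<in> borel_measurable borel"
  by (simp add: measurable_cong_sets[OF sets_haar refl])

lemma L2_measurable: "p \<in> L2 \<Longrightarrow> p \<in> borel_measurable borel"
  by (simp add: L2_def)

lemma L2_integrable_square: "p \<in> L2 \<Longrightarrow> integrable haar (\<lambda>x. (p x)\<^sup>2)"
  by (simp add: L2_def)

lemma L2_integrable_mult:
  assumes "p \<in> L2" "q \<in> L2"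
  shows "integrable haar (\<lambda>x. p x * q x)"
proof (rule Bochner_Integration.integrable_bound)
  show "integrable haar (\<lambda>x. (p x)\<^sup>2 + (q x)\<^sup>2)"
    using assms by (intro Bochner_Integration.integrable_add L2_integrable_square)
  show "(\<lambda>x. p x * q x) \<in> borel_measurable haar"
    using assms[THEN L2_measurable] by measurable
  have "\<bar>a * b\<bar> \<le> a\<^sup>2 + b\<^sup>2" for a b :: real
  proof -
    have "2 * \<bar>a\<bar> * \<bar>b\<bar> \<le> \<bar>a\<bar>\<^sup>2 + \<bar>b\<bar>\<^sup>2" by (rule sum_squares_bound)
    moreover have "0 \<le> \<bar>a\<bar> * \<bar>b\<bar>" by simp
    ultimately show ?thesis unfolding abs_mult power2_abs by linarith
  qed
  then show "AE x in haar. norm (p x * q x) \<le> norm ((p x)\<^sup>2 + (q x)\<^sup>2)" by simp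
qed

lemma L2_bounded:
  assumes "f \<in> borel_measurable borel" "\<And>x. \<bar>f x\<bar> \<le> B"
  shows "f \<in> L2"
proof -
  have "integrable haar (\<lambda>x. (f x)\<^sup>2)"
  proof (rule finite_borel_integrable[where B="B\<^sup>2"])
    show "\<bar>(f x)\<^sup>2\<bar> \<le> B\<^sup>2" for x
      using power_mono[OF assms(2)[of x], of 2] by simp
  qed (use assms in \<open>auto simp: haar.finite_measure_axioms\<close>)
  with assms show ?thesis by (simp add: L2_def)
qed

lemma L2_integrable: "p \<in> L2 \<Longrightarrow> integrable haar p"
  using L2_integrable_mult[of p "\<lambda>_. 1"] L2_bounded[of "\<lambda>_. 1" 1] by simp

lemma L2_scale: "p \<in> L2 \<Longrightarrow> (\<lambda>x. c * p x) \<in> L2"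
  by (auto simp: L2_def power_mult_distrib)

lemma L2_add:
  assumes "p \<in> L2" "q \<in> L2"
  shows "(\<lambda>x. p x + q x) \<in> L2"
proof -
  have "integrable haar (\<lambda>x. (p x)\<^sup>2 + (q x)\<^sup>2 + 2 * (p x * q x))"
    using assms by (intro Bochner_Integration.integrable_add integrable_mult_right
      L2_integrable_square L2_integrable_mult)
  then show ?thesis using assms by (auto simp: L2_def power2_sum mult.assoc)
qed

lemma L2_diff: "p \<in> L2 \<Longrightarrow> q \<in> L2 \<Longrightarrow> (\<lambda>x. p x - q x) \<in> L2"
  using L2_add[of p "\<lambda>x. -1 * q x"] L2_scale[of q "-1"] by simp

section \<open>Inner product calculus and completeness of L2\<close>

lemma l2_inner_commute: "l2_inner p q = l2_inner q p"
  by (simp add: l2_inner_def mult.commute)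

lemma l2_inner_scale_left: "l2_inner (\<lambda>x. c * p x) q = c * l2_inner p q"
  by (simp add: l2_inner_def mult.assoc)

lemma l2_inner_add_left:
  "p \<in> L2 \<Longrightarrow> q \<in> L2 \<Longrightarrow> r \<in> L2 \<Longrightarrow> l2_inner (\<lambda>x. p x + q x) r = l2_inner p r + l2_inner q r"
  unfolding l2_inner_def by (simp add: distrib_right L2_integrable_mult)

lemma l2_inner_diff_left:
  "p \<in> L2 \<Longrightarrow> q \<in> L2 \<Longrightarrow> r \<in> L2 \<Longrightarrow> l2_inner (\<lambda>x. p x - q x) r = l2_inner p r - l2_inner q r"
  unfolding l2_inner_def by (simp add: left_diff_distrib L2_integrable_mult)

lemma l2_inner_scale_right: "l2_inner p (\<lambda>x. c * q x) = c * l2_inner p q"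
  using l2_inner_scale_left[of c q p] by (simp add: l2_inner_commute[of p])

lemma l2_inner_add_right:
  "p \<in> L2 \<Longrightarrow> q \<in> L2 \<Longrightarrow> r \<in> L2 \<Longrightarrow> l2_inner r (\<lambda>x. p x + q x) = l2_inner r p + l2_inner r q"
  using l2_inner_add_left[of p q r] by (simp add: l2_inner_commute[of r])

lemma l2_inner_diff_right:
  "p \<in> L2 \<Longrightarrow> q \<in> L2 \<Longrightarrow> r \<in> L2 \<Longrightarrow> l2_inner r (\<lambda>x. p x - q x) = l2_inner r p - l2_inner r q"
  using l2_inner_diff_left[of p q r] by (simp add: l2_inner_commute[of r])

lemma l2_inner_nonneg: "0 \<le> l2_inner p p"
  by (simp add: l2_inner_def)

lemma l2_norm_nonneg: "0 \<le> l2_norm p"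
  by (simp add: l2_norm_def l2_inner_nonneg)

lemma l2_norm_square: "(l2_norm p)\<^sup>2 = l2_inner p p"
  by (simp add: l2_norm_def l2_inner_nonneg)

lemma l2_norm_add_square:
  assumes "p \<in> L2" "q \<in> L2"
  shows "(l2_norm (\<lambda>x. p x + q x))\<^sup>2 = (l2_norm p)\<^sup>2 + 2 * l2_inner p q + (l2_norm q)\<^sup>2"
  using assms
  by (simp add: l2_norm_square l2_inner_add_left l2_inner_add_right L2_add l2_inner_commute[of q p])

lemma l2_norm_diff_square:
  assumes "p \<in> L2" "q \<in> L2"
  shows "(l2_norm (\<lambda>x. p x - q x))\<^sup>2 = (l2_norm p)\<^sup>2 - 2 * l2_inner p q + (l2_norm q)\<^sup>2"
  using assms
  by (simp add: l2_norm_square l2_inner_diff_left l2_inner_diff_right L2_diff l2_inner_commute[of q p])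

lemma l2_norm_scale: "l2_norm (\<lambda>x. c * p x) = \<bar>c\<bar> * l2_norm p"
  by (simp add: l2_norm_def l2_inner_scale_left l2_inner_scale_right real_sqrt_mult mult.assoc[symmetric])

lemma l2_norm_diff_commute: "l2_norm (\<lambda>x. p x - q x) = l2_norm (\<lambda>x. q x - p x)"
  using l2_norm_scale[of "-1" "\<lambda>x. q x - p x"] by simp

text \<open>The discriminant of a nonnegative quadratic, including the degenerate case
  \<open>c = 0\<close>, where the affine function forces b = 0.\<close>

lemma quadratic_nonneg_imp:
  fixes a b c :: real
  assumes "0 \<le> c" "\<And>t. 0 \<le> a + 2 * t * b + t\<^sup>2 * c"
  shows "b\<^sup>2 \<le> a * c"
proof (cases "c = 0")
  case True
  have "b = 0"
  proof (rule ccontr)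
    assume "b \<noteq> 0"
    \<comment> \<open>At this t the affine function takes the value -1.\<close>
    then have "2 * (-(a + 1) / (2 * b)) * b = -(a + 1)" by simp
    then show False using assms(2)[of "-(a + 1) / (2 * b)"] True by simp
  qed
  then show ?thesis using True by simp
next
  case False
  then have "0 < c" using assms(1) by simp
  have "0 \<le> a - b\<^sup>2 / c"
    using assms(2)[of "- b / c"] False by (simp add: power2_eq_square power_divide)
  then show ?thesis using \<open>0 < c\<close> by (simp add: field_simps)
qed

lemma l2_Cauchy_Schwarz:
  assumes "p \<in> L2" "q \<in> L2"
  shows "\<bar>l2_inner p q\<bar> \<le> l2_norm p * l2_norm q"
proof -
  have "0 \<le> (l2_norm p)\<^sup>2 + 2 * t * l2_inner p q + t\<^sup>2 * (l2_norm q)\<^sup>2" for t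
    using l2_norm_add_square[OF assms(1) L2_scale[OF assms(2)], of t]
      zero_le_power2[of "l2_norm (\<lambda>x. p x + t * q x)"]
    by (simp add: l2_norm_scale l2_inner_scale_right power_mult_distrib)
  then have "(l2_inner p q)\<^sup>2 \<le> (l2_norm p)\<^sup>2 * (l2_norm q)\<^sup>2"
    by (intro quadratic_nonneg_imp) auto
  then have "\<bar>l2_inner p q\<bar>\<^sup>2 \<le> (l2_norm p * l2_norm q)\<^sup>2" by (simp add: power_mult_distrib)
  then show ?thesis by (rule power2_le_imp_le) (simp add: l2_norm_nonneg)
qed

lemma l2_norm_triangle:
  assumes "p \<in> L2" "q \<in> L2"
  shows "l2_norm (\<lambda>x. p x + q x) \<le> l2_norm p + l2_norm q"
proof (rule power2_le_imp_le)
  show "(l2_norm (\<lambda>x. p x + q x))\<^sup>2 \<le> (l2_norm p + l2_norm q)\<^sup>2"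
    using l2_Cauchy_Schwarz[OF assms] by (simp add: l2_norm_add_square[OF assms] power2_sum)
qed (simp add: l2_norm_nonneg)

text \<open>Cauchy-Schwarz against the constant 1, as \<open>haar\<close> has mass 1. Through this
  bound L1 arguments become available for L2.\<close>

lemma integral_abs_le_l2_norm:
  assumes "p \<in> L2"
  shows "(\<integral>x. \<bar>p x\<bar> \<partial>haar) \<le> l2_norm p"
proof -
  have "(\<lambda>x. \<bar>p x\<bar>) \<in> L2" using assms by (auto simp: L2_def)
  moreover have "(\<lambda>_. 1) \<in> L2" by (rule L2_bounded[of _ 1]) auto
  ultimately have "\<bar>l2_inner (\<lambda>x. \<bar>p x\<bar>) (\<lambda>_. 1)\<bar> \<le> l2_norm (\<lambda>x. \<bar>p x\<bar>) * l2_norm (\<lambda>_. 1)"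
    by (rule l2_Cauchy_Schwarz)
  then show ?thesis using haar.prob_space by (simp add: l2_inner_def l2_norm_def)
qed

lemma l2_inner_cong_AE:
  assumes "AE x in haar. p x = p' x" "p \<in> borel_measurable borel" "p' \<in> borel_measurable borel" "q \<in> L2"
  shows "l2_inner p q = l2_inner p' q"
proof -
  have [measurable]: "q \<in> borel_measurable borel" using assms(4) by (rule L2_measurable)
  have [measurable]: "p \<in> borel_measurable borel" "p' \<in> borel_measurable borel" by fact+
  show ?thesis unfolding l2_inner_def by (rule integral_cong_AE) (use assms(1) in auto)
qed

lemma l2_norm_eq_0:
  assumes "p \<in> L2" "l2_norm p = 0"
  shows "AE x in haar. p x = 0"
proof -
  have "(\<integral>x. (p x)\<^sup>2 \<partial>haar) = 0"
    using assms(2) l2_norm_square[of p] by (simp add: l2_inner_def power2_eq_square)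
  then have "AE x in haar. (p x)\<^sup>2 = 0"
    using integral_nonneg_eq_0_iff_AE[OF L2_integrable_square[OF assms(1)]] by simp
  then show ?thesis by simp
qed

lemma nn_integral_square_eq: "p \<in> L2 \<Longrightarrow> (\<integral>\<^sup>+x. ennreal ((p x)\<^sup>2) \<partial>haar) = ennreal ((l2_norm p)\<^sup>2)"
  by (subst nn_integral_eq_integral[OF L2_integrable_square])
    (simp_all add: l2_norm_square, simp add: l2_inner_def power2_eq_square)

text \<open>Riesz-Fischer: an L2 Cauchy sequence is Cauchy in L1, so a subsequence converges almost
  everywhere, and Fatou's lemma transfers the Cauchy bound to the limit.\<close>

lemma L2_complete:
  assumes q: "\<And>n. q n \<in> L2"
    and cauchy: "\<And>e. 0 < e \<Longrightarrow> \<exists>N. \<forall>i\<ge>N. \<forall>j\<ge>N. l2_norm (\<lambda>x. q i x - q j x) < e"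
  obtains p where "p \<in> L2" "(\<lambda>n. l2_norm (\<lambda>x. q n x - p x)) \<longlonglongrightarrow> 0"
proof -
  have meas [measurable]: "q n \<in> borel_measurable borel" for n using q by (rule L2_measurable)
  obtain r where r: "strict_mono r" "AE x in haar. Cauchy (\<lambda>i. q (r i) x)"
  proof (rule cauchy_L1_AE_cauchy_subseq[of haar q])
    show "integrable haar (q n)" for n using q by (rule L2_integrable)
    fix e :: real assume "0 < e"
    then obtain N where N: "\<forall>i\<ge>N. \<forall>j\<ge>N. l2_norm (\<lambda>x. q i x - q j x) < e" using cauchy by blast
    show "\<exists>N. \<forall>i\<ge>N. \<forall>j\<ge>N. (LINT x|haar. norm (q i x - q j x)) < e"
    proof (intro exI[of _ N] allI impI)
      fix i j assume "N \<le> i" "N \<le> j"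
      then show "(LINT x|haar. norm (q i x - q j x)) < e"
        using le_less_trans[OF integral_abs_le_l2_norm[OF L2_diff[OF q[of i] q[of j]]]] N by simp
    qed
  qed
  define p where "p x = lim (\<lambda>i. q (r i) x)" for x
  have [measurable]: "p \<in> borel_measurable borel" unfolding p_def by measurable
  have lim: "AE x in haar. (\<lambda>i. q (r i) x) \<longlonglongrightarrow> p x"
    using r(2) by eventually_elim (simp add: p_def real_Cauchy_convergent convergent_LIMSEQ_iff[symmetric])
  have tail: "\<exists>N. \<forall>n\<ge>N. (\<lambda>x. q n x - p x) \<in> L2 \<and> l2_norm (\<lambda>x. q n x - p x) \<le> e" if e: "0 < e" for e
  proof -
    obtain N where N: "\<forall>i\<ge>N. \<forall>j\<ge>N. l2_norm (\<lambda>x. q i x - q j x) < e" using cauchy[OF e] by blast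
    have "(\<lambda>x. q n x - p x) \<in> L2 \<and> l2_norm (\<lambda>x. q n x - p x) \<le> e" if n: "N \<le> n" for n
    proof -
      have "(\<integral>\<^sup>+x. ennreal ((q n x - p x)\<^sup>2) \<partial>haar)
          = (\<integral>\<^sup>+x. liminf (\<lambda>k. ennreal ((q n x - q (r k) x)\<^sup>2)) \<partial>haar)"
      proof (rule nn_integral_cong_AE)
        show "AE x in haar. ennreal ((q n x - p x)\<^sup>2) = liminf (\<lambda>k. ennreal ((q n x - q (r k) x)\<^sup>2))"
          using lim
        proof eventually_elim
          case (elim x)
          have "(\<lambda>k. ennreal ((q n x - q (r k) x)\<^sup>2)) \<longlonglongrightarrow> ennreal ((q n x - p x)\<^sup>2)"
            by (intro tendsto_intros elim)
          then show ?case by (rule lim_imp_Liminf[OF trivial_limit_sequentially, symmetric])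
        qed
      qed
      also have "\<dots> \<le> liminf (\<lambda>k. \<integral>\<^sup>+x. ennreal ((q n x - q (r k) x)\<^sup>2) \<partial>haar)"
        by (rule nn_integral_liminf) measurable
      also have "\<dots> = liminf (\<lambda>k. ennreal ((l2_norm (\<lambda>x. q n x - q (r k) x))\<^sup>2))"
        by (simp add: nn_integral_square_eq[OF L2_diff[OF q q]])
      also have "\<dots> \<le> ennreal (e\<^sup>2)"
      proof (rule Liminf_le)
        show "eventually (\<lambda>k. ennreal ((l2_norm (\<lambda>x. q n x - q (r k) x))\<^sup>2) \<le> ennreal (e\<^sup>2)) sequentially"
          unfolding eventually_sequentially
        proof (intro exI[of _ N] allI impI ennreal_leI power_mono l2_norm_nonneg)
          fix k assume "N \<le> k"
          then have "N \<le> r k" using seq_suble[OF r(1), of k] by linarith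
          then show "l2_norm (\<lambda>x. q n x - q (r k) x) \<le> e" using N n by (simp add: less_imp_le)
        qed
      qed simp
      finally have le: "(\<integral>\<^sup>+x. ennreal ((q n x - p x)\<^sup>2) \<partial>haar) \<le> ennreal (e\<^sup>2)" .
      have "integrable haar (\<lambda>x. (q n x - p x)\<^sup>2)"
        using le by (intro integrableI_bounded) (auto intro: le_less_trans)
      then have L: "(\<lambda>x. q n x - p x) \<in> L2" by (simp add: L2_def)
      have "(l2_norm (\<lambda>x. q n x - p x))\<^sup>2 \<le> e\<^sup>2"
        using le by (simp add: nn_integral_square_eq[OF L])
      then show ?thesis using L e by (auto intro: power2_le_imp_le)
    qed
    then show ?thesis by blast
  qed
  \<comment> \<open>Fatou only places the difference in L2; \<open>p\<close> itself is recovered as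
    q n - (q n - p).\<close>
  obtain n where "(\<lambda>x. q n x - p x) \<in> L2" using tail[of 1] by auto
  then have "(\<lambda>x. q n x - (q n x - p x)) \<in> L2" by (rule L2_diff[OF q])
  then have "p \<in> L2" by simp
  moreover have "(\<lambda>n. l2_norm (\<lambda>x. q n x - p x)) \<longlonglongrightarrow> 0"
  proof (rule LIMSEQ_I)
    fix e :: real assume "0 < e"
    then obtain N where "\<forall>n\<ge>N. l2_norm (\<lambda>x. q n x - p x) \<le> e / 2" using tail[of "e/2"] by auto
    then show "\<exists>N. \<forall>n\<ge>N. norm (l2_norm (\<lambda>x. q n x - p x) - 0) < e"
      using \<open>0 < e\<close> by (intro exI[of _ N]) (auto simp: l2_norm_nonneg intro: le_less_trans)
  qed
  ultimately show ?thesis by (rule that)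
qed

lemma abs_integral_mult_le:
  assumes p: "p \<in> L2" and f: "f \<in> borel_measurable borel" "\<And>x. \<bar>f x\<bar> \<le> c"
  shows "\<bar>\<integral>x. f x * p x \<partial>haar\<bar> \<le> c * l2_norm p"
proof -
  have int: "integrable haar (\<lambda>x. f x * p x)"
    using L2_bounded[OF f] p by (rule L2_integrable_mult)
  have "\<bar>\<integral>x. f x * p x \<partial>haar\<bar> \<le> (\<integral>x. \<bar>f x * p x\<bar> \<partial>haar)" by (rule integral_abs_bound)
  also have "\<dots> \<le> (\<integral>x. c * \<bar>p x\<bar> \<partial>haar)"
    by (intro integral_mono integrable_abs integrable_mult_right int L2_integrable p)
      (use f(2) in \<open>auto simp: abs_mult intro: mult_right_mono\<close>)
  also have "\<dots> \<le> c * l2_norm p"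
    using integral_abs_le_l2_norm[OF p] f(2)[of 0] by (auto intro!: mult_left_mono)
  finally show ?thesis .
qed

section \<open>The operator with a continuous kernel and its adjoint\<close>

context
  fixes \<phi> :: "torus \<Rightarrow> real"
  assumes \<phi>: "continuous_on UNIV \<phi>"
begin

lemma kernel_measurable: "(\<lambda>z. \<phi> (fst z - snd z)) \<in> borel_measurable (borel \<Otimes>\<^sub>M borel)"
proof -
  have "continuous_on UNIV (\<lambda>z. \<phi> (fst z - snd z))"
    using continuous_on_compose2[OF \<phi> continuous_on_torus_minus] by simp
  then show ?thesis by (simp add: borel_prod borel_measurable_continuous_onI)
qed

lemma kernel_measurable_left: "(\<lambda>x. \<phi> (x - t)) \<in> borel_measurable borel"
  using measurable_compose[OF measurable_Pair2'[of t borel borel] kernel_measurable] by simp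

lemma kernel_measurable_right: "(\<lambda>x. \<phi> (t - x)) \<in> borel_measurable borel"
  using measurable_compose[OF measurable_Pair1'[of t borel borel] kernel_measurable] by simp

lemma kernel_bound: "\<bar>\<phi> x\<bar> \<le> sup_norm \<phi>"
  using \<phi> by (rule abs_le_sup_norm)

lemma sup_norm_kernel_nonneg: "0 \<le> sup_norm \<phi>"
  using kernel_bound[of 0] by linarith

lemma continuous_kernel_left: "continuous_on UNIV (\<lambda>x. \<phi> (x - t))"
proof -
  have "continuous_on UNIV (\<lambda>x. x - t)"
    by (rule continuous_onI) (auto simp: dist_torus_diff_right intro: less_imp_le)
  then show ?thesis using continuous_on_compose2[OF \<phi>] by blast
qed

lemma Phi_bound: "m \<in> radon_measures \<Longrightarrow> \<bar>Phi \<phi> m t\<bar> \<le> sup_norm \<phi> * tv_norm m"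
  unfolding Phi_def tv_norm_eq_total_mass
  by (rule abs_signed_integral_le) (auto intro: kernel_measurable_left kernel_bound)

lemma Phi_measurable:
  assumes m: "m \<in> radon_measures"
  shows "Phi \<phi> m \<in> borel_measurable borel"
proof -
  have "(\<lambda>t. \<integral>x. \<phi> (x - t) \<partial>M) \<in> borel_measurable borel"
    if M: "finite_measure M" "sets M = sets borel" for M
  proof -
    interpret finite_measure M by fact
    have "(\<lambda>(t, x). \<phi> (x - t)) \<in> borel_measurable (borel \<Otimes>\<^sub>M M)"
      using measurable_compose[OF measurable_pair_swap' kernel_measurable]
      by (simp add: split_beta' measurable_cong_sets[OF sets_pair_measure_cong[OF refl M(2)] refl])
    then show ?thesis by (rule borel_measurable_lebesgue_integral)
  qed
  then show ?thesis
    unfolding Phi_def[abs_def] signed_integral_def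
    by (intro borel_measurable_diff) (auto simp: finite_pos_part finite_neg_part m)
qed

lemma Phi_L2: "m \<in> radon_measures \<Longrightarrow> Phi \<phi> m \<in> L2"
  by (rule L2_bounded[OF Phi_measurable Phi_bound])

lemma Phi_lincomb:
  assumes "m \<in> radon_measures" "m' \<in> radon_measures"
  shows "Phi \<phi> (\<lambda>A. a * m A + b * m' A) t = a * Phi \<phi> m t + b * Phi \<phi> m' t"
  unfolding Phi_def using assms continuous_kernel_left by (rule signed_integral_lincomb_continuous)

lemma Phi_adj_integrable:
  assumes "p \<in> L2"
  shows "integrable haar (\<lambda>x. \<phi> (t - x) * p x)"
  using L2_bounded[OF kernel_measurable_right kernel_bound] assms by (rule L2_integrable_mult)

lemma Phi_adj_scale: "Phi_adj \<phi> (\<lambda>x. c * p x) t = c * Phi_adj \<phi> p t"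
  unfolding Phi_adj_def by (simp add: mult.left_commute)

lemma Phi_adj_add:
  "p \<in> L2 \<Longrightarrow> q \<in> L2 \<Longrightarrow> Phi_adj \<phi> (\<lambda>x. p x + q x) t = Phi_adj \<phi> p t + Phi_adj \<phi> q t"
  unfolding Phi_adj_def by (simp add: distrib_left Phi_adj_integrable)

lemma Phi_adj_diff:
  "p \<in> L2 \<Longrightarrow> q \<in> L2 \<Longrightarrow> Phi_adj \<phi> (\<lambda>x. p x - q x) t = Phi_adj \<phi> p t - Phi_adj \<phi> q t"
  unfolding Phi_adj_def by (simp add: right_diff_distrib Phi_adj_integrable)

lemma Phi_adj_bound: "p \<in> L2 \<Longrightarrow> \<bar>Phi_adj \<phi> p t\<bar> \<le> sup_norm \<phi> * l2_norm p"
  unfolding Phi_adj_def by (rule abs_integral_mult_le) (auto intro: kernel_measurable_right kernel_bound)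

lemma Phi_adj_continuous:
  assumes p: "p \<in> L2"
  shows "continuous_on UNIV (Phi_adj \<phi> p)"
proof (rule continuous_onI)
  fix t :: torus and e :: real assume e: "0 < e"
  \<comment> \<open>The summand 1 keeps the denominator positive when p has norm 0.\<close>
  define e' where "e' = e / (l2_norm p + 1)"
  have e': "0 < e'" using e l2_norm_nonneg[of p] by (simp add: e'_def)
  have "uniformly_continuous_on UNIV \<phi>"
    using \<phi> compact_torus_UNIV by (rule compact_uniformly_continuous)
  then obtain d where d: "0 < d" "\<And>x y. dist x y < d \<Longrightarrow> dist (\<phi> x) (\<phi> y) < e'"
    using e' unfolding uniformly_continuous_on_def by (metis UNIV_I)
  show "\<exists>d>0. \<forall>t'\<in>UNIV. dist t' t < d \<longrightarrow> dist (Phi_adj \<phi> p t') (Phi_adj \<phi> p t) \<le> e"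
  proof (intro exI[of _ d] conjI ballI impI)
    fix t' assume t': "dist t' t < d"
    have "\<bar>\<integral>x. (\<phi> (t' - x) - \<phi> (t - x)) * p x \<partial>haar\<bar> \<le> e' * l2_norm p"
    proof (rule abs_integral_mult_le[OF p])
      show "(\<lambda>x. \<phi> (t' - x) - \<phi> (t - x)) \<in> borel_measurable borel"
        by (intro borel_measurable_diff kernel_measurable_right)
      show "\<bar>\<phi> (t' - x) - \<phi> (t - x)\<bar> \<le> e'" for x
        using d(2)[of "t' - x" "t - x"] t' by (simp add: dist_torus_diff_right dist_real_def)
    qed
    also have "\<dots> \<le> e"
      using e l2_norm_nonneg[of p] by (simp add: e'_def field_simps)
    finally show "dist (Phi_adj \<phi> p t') (Phi_adj \<phi> p t) \<le> e"
      unfolding Phi_adj_def dist_real_def using p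
      by (simp add: left_diff_distrib Phi_adj_integrable)
  qed (rule d)
qed

text \<open>Fubini on each Jordan part. The product integrand is integrable because the kernel is
  bounded and L2 functions are integrable for \<open>haar\<close>. Every pairing of a measure with a
  certificate becomes an L2 inner product this way.\<close>

lemma signed_integral_Phi_adj:
  assumes m: "m \<in> radon_measures" and p: "p \<in> L2"
  shows "signed_integral m (Phi_adj \<phi> p) = l2_inner p (Phi \<phi> m)"
proof -
  have fubini: "integrable haar (\<lambda>x. p x * (\<integral>t. \<phi> (t - x) \<partial>M)) \<and>
      integral\<^sup>L M (Phi_adj \<phi> p) = (\<integral>x. p x * (\<integral>t. \<phi> (t - x) \<partial>M) \<partial>haar)"
    if M: "finite_measure M" "sets M = sets borel" for M
  proof -
    interpret M: finite_measure M by fact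
    interpret pair_sigma_finite M haar ..
    have pm: "(\<lambda>z. p (snd z)) \<in> borel_measurable (borel \<Otimes>\<^sub>M borel)"
      using measurable_compose[OF measurable_snd L2_measurable[OF p]] .
    have km: "(\<lambda>(t, x). \<phi> (t - x) * p x) \<in> borel_measurable (M \<Otimes>\<^sub>M haar)"
      unfolding measurable_cong_sets[OF sets_pair_measure_cong[OF M(2) sets_haar] refl] split_beta'
      by (intro borel_measurable_times kernel_measurable pm)
    have int: "integrable (M \<Otimes>\<^sub>M haar) (\<lambda>(t, x). \<phi> (t - x) * p x)"
    proof (rule Fubini_integrable[OF km])
      show "AE t in M. integrable haar (\<lambda>x. case (t, x) of (t, x) \<Rightarrow> \<phi> (t - x) * p x)"
        using Phi_adj_integrable[OF p] by simp
      have [measurable]: "(\<lambda>t. \<integral>x. norm (case (t, x) of (t, x) \<Rightarrow> \<phi> (t - x) * p x) \<partial>haar) \<in> borel_measurable M"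
        using km by measurable
      show "integrable M (\<lambda>t. \<integral>x. norm (case (t, x) of (t, x) \<Rightarrow> \<phi> (t - x) * p x) \<partial>haar)"
      proof (rule M.integrable_const_bound[where B="sup_norm \<phi> * l2_norm p"])
        have "norm (\<integral>x. norm (\<phi> (t - x) * p x) \<partial>haar) \<le> sup_norm \<phi> * l2_norm p" for t
        proof -
          have "(\<integral>x. \<bar>\<phi> (t - x) * p x\<bar> \<partial>haar) \<le> (\<integral>x. sup_norm \<phi> * \<bar>p x\<bar> \<partial>haar)"
            by (intro integral_mono integrable_abs integrable_mult_right Phi_adj_integrable L2_integrable p)
              (use kernel_bound in \<open>auto simp: abs_mult intro: mult_right_mono\<close>)
          also have "\<dots> \<le> sup_norm \<phi> * l2_norm p"
            using integral_abs_le_l2_norm[OF p] sup_norm_kernel_nonneg by (auto intro: mult_left_mono)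
          finally show ?thesis by simp
        qed
        then show "AE t in M. norm (\<integral>x. norm (case (t, x) of (t, x) \<Rightarrow> \<phi> (t - x) * p x) \<partial>haar)
            \<le> sup_norm \<phi> * l2_norm p" by simp
      qed measurable
    qed
    show ?thesis
      using integrable_snd[OF int] Fubini_integral[OF int]
      unfolding Phi_adj_def[abs_def] by (simp add: mult.commute[of "p _"])
  qed
  show ?thesis
    using fubini[OF finite_pos_part[OF m] sets_pos_part] fubini[OF finite_neg_part[OF m] sets_neg_part]
    unfolding signed_integral_def l2_inner_def Phi_def by (simp add: right_diff_distrib)
qed

end

section \<open>Optimality and duality\<close>

text \<open>Saturation says that the integrals of 1 - \<eta> against the positive part and of 1 +
  \<eta> against the negative part sum to at most 0. Both integrands are nonnegative, so \<eta> is
  1, respectively -1, almost everywhere; the exceptional set is open by continuity, and an open null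
  set misses the support.\<close>

lemma saturated_signed_supp:
  assumes m: "m \<in> radon_measures" and \<eta>: "continuous_on UNIV \<eta>" "\<And>x. \<bar>\<eta> x\<bar> \<le> 1"
    and sat: "tv_norm m \<le> signed_integral m \<eta>" and t: "(t, v) \<in> signed_supp m"
  shows "v \<in> {1, -1} \<and> \<eta> t = v"
proof -
  interpret P: finite_measure "pos_part m" by (rule finite_pos_part[OF m])
  interpret N: finite_measure "neg_part m" by (rule finite_neg_part[OF m])
  have intP: "integrable (pos_part m) \<eta>" and intN: "integrable (neg_part m) \<eta>"
    using continuous_integrable[OF finite_pos_part[OF m] _ \<eta>(1)]
      continuous_integrable[OF finite_neg_part[OF m] _ \<eta>(1)] by simp_all
  have le: "\<eta> x \<le> 1" "- 1 \<le> \<eta> x" for x using \<eta>(2)[of x] by (simp_all add: abs_le_iff)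
  have eqP: "(\<integral>x. 1 - \<eta> x \<partial>pos_part m) = measure (pos_part m) UNIV - integral\<^sup>L (pos_part m) \<eta>"
    using intP by simp
  have eqN: "(\<integral>x. 1 + \<eta> x \<partial>neg_part m) = measure (neg_part m) UNIV + integral\<^sup>L (neg_part m) \<eta>"
    using intN by simp
  have "0 \<le> (\<integral>x. 1 - \<eta> x \<partial>pos_part m)" "0 \<le> (\<integral>x. 1 + \<eta> x \<partial>neg_part m)"
  proof -
    have "0 \<le> 1 - \<eta> x" "0 \<le> 1 + \<eta> x" for x using le[of x] by linarith+
    then show "0 \<le> (\<integral>x. 1 - \<eta> x \<partial>pos_part m)" "0 \<le> (\<integral>x. 1 + \<eta> x \<partial>neg_part m)"
      by (intro integral_nonneg_AE AE_I2; blast)+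
  qed
  moreover have "(\<integral>x. 1 - \<eta> x \<partial>pos_part m) + (\<integral>x. 1 + \<eta> x \<partial>neg_part m) \<le> 0"
    using sat tv_norm_eq_total_mass[OF m]
    unfolding eqP eqN signed_integral_def total_mass_def by linarith
  ultimately have zero: "(\<integral>x. 1 - \<eta> x \<partial>pos_part m) = 0" "(\<integral>x. 1 + \<eta> x \<partial>neg_part m) = 0" by linarith+
  have aeP: "AE x in pos_part m. \<eta> x = 1"
    using zero(1) integral_nonneg_eq_0_iff_AE[of "pos_part m" "\<lambda>x. 1 - \<eta> x"] intP le by simp
  have "0 \<le> 1 + \<eta> x" for x using le(2)[of x] by linarith
  then have "AE x in neg_part m. 1 + \<eta> x = 0"
    using zero(2) integral_nonneg_eq_0_iff_AE[of "neg_part m" "\<lambda>x. 1 + \<eta> x"] intN by simp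
  then have aeN: "AE x in neg_part m. \<eta> x = -1" by eventually_elim simp
  have supp: "\<eta> t = c" if ae: "AE x in M. \<eta> x = c" and t: "t \<in> measure_supp M"
    and M: "sets M = sets borel" for M c
  proof (rule ccontr)
    assume "\<eta> t \<noteq> c"
    let ?U = "{x. \<eta> x \<noteq> c}"
    have op: "open ?U" using \<eta>(1) by (intro open_Collect_neq) (auto intro: continuous_intros)
    have "emeasure M ?U = 0"
      using ae op M sets_eq_imp_space_eq[OF M] by (subst (asm) AE_iff_measurable[OF _ refl]) auto
    moreover have "emeasure M ?U \<noteq> 0" using t op \<open>\<eta> t \<noteq> c\<close> unfolding measure_supp_def by blast
    ultimately show False by simp
  qed
  from t show ?thesis
    unfolding signed_supp_def using supp[OF aeP] supp[OF aeN] by auto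
qed

text \<open>The one-sided derivative at a minimum along a segment: divide by s and let s tend to
  0.\<close>

lemma first_order_nonneg:
  fixes a b :: real
  assumes "\<And>s. 0 < s \<Longrightarrow> s \<le> 1 \<Longrightarrow> 0 \<le> s * a + s\<^sup>2 * b"
  shows "0 \<le> a"
proof (rule field_le_epsilon)
  fix e :: real assume e: "0 < e"
  define s where "s = min 1 (e / (\<bar>b\<bar> + 1))"
  have s: "0 < s" "s \<le> 1" using e by (auto simp: s_def)
  have "s * (\<bar>b\<bar> + 1) \<le> e"
  proof -
    have "s \<le> e / (\<bar>b\<bar> + 1)" by (simp add: s_def)
    then show ?thesis by (simp add: field_simps)
  qed
  moreover have "s * b \<le> s * (\<bar>b\<bar> + 1)" using s by (intro mult_left_mono) auto
  moreover have "0 \<le> s * (a + s * b)" using assms[OF s] by (simp add: power2_eq_square algebra_simps)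
  then have "0 \<le> a + s * b" using s by (simp add: zero_le_mult_iff)
  ultimately show "0 \<le> a + e" by linarith
qed

text \<open>On the compact complement of the balls around the points where f = c, the function stays
  a fixed amount below c. If c is not attained, that complement is the whole torus and \<delta>
  makes the premise void.\<close>

lemma near_maximum_near_maximiser:
  fixes f :: "torus \<Rightarrow> real"
  assumes f: "continuous_on UNIV f" "\<And>x. f x \<le> c" and e: "0 < \<epsilon>"
  shows "\<exists>\<delta>>0. \<forall>t. c - \<delta> < f t \<longrightarrow> (\<exists>s. f s = c \<and> dist t s < \<epsilon>)"
proof -
  define K where "K = - (\<Union>s\<in>{s. f s = c}. ball s \<epsilon>)"
  have K: "compact K" unfolding K_def by (intro compact_torus closed_Compl open_UN ballI open_ball)
  have out: "\<exists>s. f s = c \<and> dist t s < \<epsilon>" if "t \<notin> K" for t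
    using that by (auto simp: K_def dist_commute)
  show ?thesis
  proof (cases "K = {}")
    case True
    then show ?thesis using out by (intro exI[of _ 1]) auto
  next
    case False
    obtain x where x: "x \<in> K" "\<And>t. t \<in> K \<Longrightarrow> f t \<le> f x"
      using continuous_attains_sup[OF K False] continuous_on_subset[OF f(1)] by blast
    have "f x \<noteq> c" using x(1) e by (auto simp: K_def)
    then have "f x < c" using f(2)[of x] by simp
    moreover have "t \<notin> K" if "c - (c - f x) < f t" for t using x(2)[of t] that by auto
    ultimately show ?thesis using out by (intro exI[of _ "c - f x"]) auto
  qed
qed

lemma D0_feasible_L2: "p \<in> D0_feasible \<phi> \<Longrightarrow> p \<in> L2"
  by (simp add: D0_feasible_def)

context
  fixes \<phi> :: "torus \<Rightarrow> real"
  assumes \<phi>: "continuous_on UNIV \<phi>"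
begin

lemma D0_feasible_iff: "p \<in> D0_feasible \<phi> \<longleftrightarrow> p \<in> L2 \<and> (\<forall>t. \<bar>Phi_adj \<phi> p t\<bar> \<le> 1)"
  unfolding D0_feasible_def using sup_norm_le_iff[OF Phi_adj_continuous[OF \<phi>]] by blast

lemma D0_feasible_midpoint:
  assumes "p \<in> D0_feasible \<phi>" "q \<in> D0_feasible \<phi>"
  shows "(\<lambda>x. 1/2 * (p x + q x)) \<in> D0_feasible \<phi>"
proof -
  have L: "p \<in> L2" "q \<in> L2" using assms by (simp_all add: D0_feasible_L2)
  have "\<bar>1/2 * (Phi_adj \<phi> p t + Phi_adj \<phi> q t)\<bar> \<le> 1" for t
    using assms by (simp add: D0_feasible_iff abs_le_iff) (smt (verit))
  then show ?thesis
    unfolding D0_feasible_iff Phi_adj_scale[OF \<phi>] Phi_adj_add[OF \<phi> L]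
    using L2_scale[OF L2_add[OF L]] by blast
qed

text \<open>The homogeneous form of dual optimality: divided by the sup norm of its image, any q
  becomes feasible.\<close>

lemma dual_bound:
  assumes sol: "solves_D0 \<phi> y p" and q: "q \<in> L2"
  shows "l2_inner y q \<le> l2_inner y p * sup_norm (Phi_adj \<phi> q)"
proof (rule field_le_epsilon)
  fix e :: real assume e: "0 < e"
  define v where "v = l2_inner y p"
  define c where "c = sup_norm (Phi_adj \<phi> q)"
  have opt: "l2_inner y r \<le> v" if "r \<in> D0_feasible \<phi>" for r
    using sol that by (simp add: solves_D0_def v_def)
  have c: "\<bar>Phi_adj \<phi> q t\<bar> \<le> c" for t
    unfolding c_def by (rule abs_le_sup_norm[OF Phi_adj_continuous[OF \<phi> q]])
  have c0: "0 \<le> c" using c[of 0] by linarith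
  have v0: "0 \<le> v"
    using opt[of "\<lambda>_. 0"] L2_bounded[of "\<lambda>_. 0" 0]
    by (simp add: D0_feasible_iff l2_inner_def Phi_adj_def)
  \<comment> \<open>The sup norm \<open>c\<close> may be 0, so the scaling uses a slightly larger
    number; the excess is chosen so that multiplied by \<open>v\<close> it costs at most
    \<open>e\<close>.\<close>
  define d where "d = c + e / (v + 1)"
  have d: "0 < d" "c \<le> d" using c0 v0 e by (auto simp: d_def intro: add_nonneg_pos)
  have "\<bar>1 / d * Phi_adj \<phi> q t\<bar> \<le> 1" for t
    using order_trans[OF c[of t] d(2)] d(1) by (simp add: abs_mult field_simps)
  then have "(\<lambda>x. 1 / d * q x) \<in> D0_feasible \<phi>"
    unfolding D0_feasible_iff Phi_adj_scale[OF \<phi>] using L2_scale[OF q] by blast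
  from opt[OF this] have "1 / d * l2_inner y q \<le> v" unfolding l2_inner_scale_right .
  then have "l2_inner y q \<le> v * d" using d by (simp add: field_simps)
  also have "v * d \<le> v * c + e"
    using v0 e by (simp add: d_def field_simps)
  finally show "l2_inner y q \<le> l2_inner y p * sup_norm (Phi_adj \<phi> q) + e" by (simp add: v_def c_def)
qed

text \<open>Puts the misfit along a segment into the shape that \<open>first_order_nonneg\<close>
  expects, for the constrained and for the penalised problem.\<close>

lemma residual_segment:
  assumes m: "m \<in> radon_measures" "m' \<in> radon_measures" and y: "y \<in> L2"
  shows "(l2_norm (\<lambda>t. Phi \<phi> (\<lambda>A. (1 - s) * m A + s * m' A) t - y t))\<^sup>2 =
    (l2_norm (\<lambda>t. Phi \<phi> m t - y t))\<^sup>2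
    + s * (2 * l2_inner (\<lambda>t. Phi \<phi> m t - y t) (\<lambda>t. Phi \<phi> m' t - Phi \<phi> m t))
    + s\<^sup>2 * (l2_norm (\<lambda>t. Phi \<phi> m' t - Phi \<phi> m t))\<^sup>2"
proof -
  have L: "Phi \<phi> m \<in> L2" "Phi \<phi> m' \<in> L2" using m Phi_L2[OF \<phi>] by auto
  have "(\<lambda>t. Phi \<phi> (\<lambda>A. (1 - s) * m A + s * m' A) t - y t)
      = (\<lambda>t. (Phi \<phi> m t - y t) + s * (Phi \<phi> m' t - Phi \<phi> m t))"
    unfolding Phi_lincomb[OF \<phi> m] by (rule ext) (simp add: algebra_simps)
  then show ?thesis
    using l2_norm_add_square[OF L2_diff[OF L(1) y] L2_scale[OF L2_diff[OF L(2) L(1)]], of s]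
    by (simp add: l2_norm_scale l2_inner_scale_right power_mult_distrib)
qed

text \<open>The direct method. Weak-* convergence makes \<open>Phi \<phi> (m n) t\<close> converge
  at every t, as the kernel is continuous in the integration variable, and uniform bounds give
  convergence of the misfit by dominated convergence.\<close>

lemma tv_norm_minimiser_over_ball:
  assumes y: "y \<in> borel_measurable borel" "\<And>t. \<bar>y t\<bar> \<le> B" and c: "0 \<le> c"
  obtains m where "m \<in> radon_measures" "tv_norm m \<le> c"
    "\<And>m'. m' \<in> radon_measures \<Longrightarrow> tv_norm m' \<le> c \<Longrightarrow>
      (l2_norm (\<lambda>t. Phi \<phi> m t - y t))\<^sup>2 \<le> (l2_norm (\<lambda>t. Phi \<phi> m' t - y t))\<^sup>2"
proof -
  define F where "F m = (l2_norm (\<lambda>t. Phi \<phi> m t - y t))\<^sup>2" for m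
  define K where "K = {m \<in> radon_measures. tv_norm m \<le> c}"
  define d where "d = Inf (F ` K)"
  have ne: "K \<noteq> {}"
    using radon_point_mass tv_norm_point_mass[of 0 0] c by (auto simp: K_def intro!: exI[of _ "point_mass 0 0"])
  have bdd: "bdd_below (F ` K)" by (intro bdd_belowI2[of _ 0]) (simp add: F_def)
  have lower: "d \<le> F m" if "m \<in> K" for m
    unfolding d_def using that bdd by (intro cInf_lower) auto
  have "\<exists>m. m \<in> K \<and> F m < d + inverse (real (Suc n))" for n
  proof -
    have "Inf (F ` K) < d + inverse (real (Suc n))" by (simp add: d_def)
    then show ?thesis using cInf_lessD[of "F ` K" "d + inverse (real (Suc n))"] ne by auto
  qed
  then obtain m where m: "\<And>n. m n \<in> K" "\<And>n. F (m n) < d + inverse (real (Suc n))" by metis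
  have mK: "m n \<in> radon_measures" "tv_norm (m n) \<le> c" for n using m(1)[of n] by (auto simp: K_def)
  obtain r m' where r: "strict_mono (r :: nat \<Rightarrow> nat)" "m' \<in> radon_measures" "tv_norm m' \<le> c"
    "\<And>f. continuous_on UNIV f \<Longrightarrow> (\<lambda>n. signed_integral (m (r n)) f) \<longlonglongrightarrow> signed_integral m' f"
    using radon_sequentially_compact[of m c] mK by blast
  have Phi_le: "\<bar>Phi \<phi> m t - y t\<bar> \<le> sup_norm \<phi> * c + B" if "m \<in> radon_measures" "tv_norm m \<le> c" for m t
  proof -
    have "\<bar>Phi \<phi> m t\<bar> \<le> sup_norm \<phi> * c"
      using Phi_bound[OF \<phi> that(1), of t] mult_left_mono[OF that(2) sup_norm_kernel_nonneg[OF \<phi>]] by linarith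
    then show ?thesis using y(2)[of t] by linarith
  qed
  have "(\<lambda>n. F (m (r n))) \<longlonglongrightarrow> F m'"
    unfolding F_def l2_norm_square l2_inner_def
  proof (rule integral_dominated_convergence[where w="\<lambda>_. (sup_norm \<phi> * c + B)\<^sup>2"])
    have meas: "(\<lambda>t. Phi \<phi> m t - y t) \<in> borel_measurable haar" if "m \<in> radon_measures" for m
      unfolding borel_measurable_haar by (intro borel_measurable_diff Phi_measurable[OF \<phi>] that y)
    show "(\<lambda>t. (Phi \<phi> m' t - y t) * (Phi \<phi> m' t - y t)) \<in> borel_measurable haar"
      "(\<lambda>t. (Phi \<phi> (m (r n)) t - y t) * (Phi \<phi> (m (r n)) t - y t)) \<in> borel_measurable haar" for n
      by (intro borel_measurable_times meas r mK)+
    show "AE t in haar. (\<lambda>n. (Phi \<phi> (m (r n)) t - y t) * (Phi \<phi> (m (r n)) t - y t))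
        \<longlonglongrightarrow> (Phi \<phi> m' t - y t) * (Phi \<phi> m' t - y t)"
      unfolding Phi_def by (intro AE_I2 tendsto_intros r continuous_kernel_left[OF \<phi>])
    show "AE t in haar. norm ((Phi \<phi> (m (r n)) t - y t) * (Phi \<phi> (m (r n)) t - y t)) \<le> (sup_norm \<phi> * c + B)\<^sup>2" for n
    proof (rule AE_I2)
      fix t
      show "norm ((Phi \<phi> (m (r n)) t - y t) * (Phi \<phi> (m (r n)) t - y t)) \<le> (sup_norm \<phi> * c + B)\<^sup>2"
        using power_mono[OF Phi_le[OF mK(1,2)], of "r n" t 2] by (simp add: power2_eq_square abs_mult)
    qed
  qed simp
  moreover have "(\<lambda>n. d + inverse (real (Suc (r n)))) \<longlonglongrightarrow> d + 0"
    using LIMSEQ_subseq_LIMSEQ[OF LIMSEQ_inverse_real_of_nat r(1)] by (intro tendsto_add) (simp_all add: comp_def)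
  ultimately have "F m' \<le> d + 0"
    by (rule LIMSEQ_le) (use m(2) in \<open>auto intro: less_imp_le\<close>)
  then have "F m' \<le> F m''" if "m'' \<in> radon_measures" "tv_norm m'' \<le> c" for m''
    using lower[of m''] that by (simp add: K_def)
  with r(2,3) show ?thesis using that unfolding F_def by blast
qed

text \<open>Let q be the residual of a best approximation in the ball of radius v, the dual value.
  Point masses of weight v and -v as competitors give v times the sup norm of
  \<open>Phi_adj \<phi> q\<close> \<le> <q, Phi m> = <y, q> - |q|^2. By \<open>dual_bound\<close>,
  <y, q> is at most the left side, so q vanishes almost everywhere.\<close>

lemma strong_duality:
  assumes m0: "m0 \<in> radon_measures" and sol: "solves_D0 \<phi> (Phi \<phi> m0) p"
  obtains m where "m \<in> P0_feasible \<phi> (Phi \<phi> m0)" "tv_norm m \<le> l2_inner (Phi \<phi> m0) p"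
proof -
  define y where "y = Phi \<phi> m0"
  define v where "v = l2_inner y p"
  have y: "y \<in> borel_measurable borel" "y \<in> L2" "\<And>t. \<bar>y t\<bar> \<le> sup_norm \<phi> * tv_norm m0"
    using m0 Phi_measurable[OF \<phi>] Phi_bound[OF \<phi>] Phi_L2[OF \<phi>] by (auto simp: y_def)
  have v0: "0 \<le> v"
  proof -
    have "(\<lambda>_. 0) \<in> D0_feasible \<phi>"
      using L2_bounded[of "\<lambda>_. 0" 0] by (simp add: D0_feasible_iff Phi_adj_def)
    then have "l2_inner y (\<lambda>_. 0) \<le> v" using sol by (simp add: solves_D0_def v_def y_def)
    then show ?thesis by (simp add: l2_inner_def)
  qed
  obtain m where m: "m \<in> radon_measures" "tv_norm m \<le> v"
    "\<And>m'. m' \<in> radon_measures \<Longrightarrow> tv_norm m' \<le> v \<Longrightarrow>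
      (l2_norm (\<lambda>t. Phi \<phi> m t - y t))\<^sup>2 \<le> (l2_norm (\<lambda>t. Phi \<phi> m' t - y t))\<^sup>2"
    using tv_norm_minimiser_over_ball[OF y(1,3) v0] by blast
  have L: "Phi \<phi> m \<in> L2" using Phi_L2[OF \<phi> m(1)] .
  define q where "q t = y t - Phi \<phi> m t" for t
  have q: "q \<in> L2" unfolding q_def using y L by (intro L2_diff)
  have var: "l2_inner q (Phi \<phi> m') \<le> l2_inner q (Phi \<phi> m)"
    if m': "m' \<in> radon_measures" "tv_norm m' \<le> v" for m'
  proof -
    have "0 \<le> 2 * l2_inner (\<lambda>t. Phi \<phi> m t - y t) (\<lambda>t. Phi \<phi> m' t - Phi \<phi> m t)"
    proof (rule first_order_nonneg)
      fix s :: real assume s: "0 < s" "s \<le> 1"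
      have "tv_norm (\<lambda>A. (1 - s) * m A + s * m' A) \<le> (1 - s) * tv_norm m + s * tv_norm m'"
        using s by (intro tv_norm_lincomb m m') auto
      also have "\<dots> \<le> (1 - s) * v + s * v"
        using s m m' by (intro add_mono mult_left_mono) auto
      finally have "tv_norm (\<lambda>A. (1 - s) * m A + s * m' A) \<le> v" by (simp add: algebra_simps)
      from m(3)[OF radon_lincomb[OF m(1) m'(1)] this]
      show "0 \<le> s * (2 * l2_inner (\<lambda>t. Phi \<phi> m t - y t) (\<lambda>t. Phi \<phi> m' t - Phi \<phi> m t))
          + s\<^sup>2 * (l2_norm (\<lambda>t. Phi \<phi> m' t - Phi \<phi> m t))\<^sup>2"
        unfolding residual_segment[OF m(1) m'(1) y(2)] by simp
    qed
    moreover have "l2_inner (\<lambda>t. Phi \<phi> m t - y t) (\<lambda>t. Phi \<phi> m' t - Phi \<phi> m t)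
        = l2_inner q (Phi \<phi> m) - l2_inner q (Phi \<phi> m')"
      using y L Phi_L2[OF \<phi> m'(1)] unfolding q_def
      by (simp add: l2_inner_diff_left l2_inner_diff_right L2_diff)
    ultimately show ?thesis by simp
  qed
  define c where "c = sup_norm (Phi_adj \<phi> q)"
  have qm: "l2_inner q (Phi \<phi> m) = l2_inner y q - (l2_norm q)\<^sup>2"
  proof -
    have "l2_inner q q = l2_inner q y - l2_inner q (Phi \<phi> m)"
      using l2_inner_diff_right[OF y(2) L q] unfolding q_def[abs_def, symmetric] .
    then show ?thesis by (simp add: l2_norm_square l2_inner_commute[of y])
  qed
  have bound: "v * \<bar>Phi_adj \<phi> q t\<bar> \<le> l2_inner q (Phi \<phi> m)" for t
  proof -
    have "x * Phi_adj \<phi> q t \<le> l2_inner q (Phi \<phi> m)" if x: "\<bar>x\<bar> \<le> v" for x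
      using var[OF radon_point_mass order_trans[OF tv_norm_point_mass x], of t]
        signed_integral_point_mass[OF Phi_adj_continuous[OF \<phi> q], of t x]
      by (simp add: signed_integral_Phi_adj[OF \<phi> radon_point_mass q])
    from this[of v] this[of "-v"] v0 show ?thesis by (cases "0 \<le> Phi_adj \<phi> q t") auto
  qed
  have "v * c \<le> l2_inner q (Phi \<phi> m)"
  \<comment> \<open>The pointwise bound passes to the supremum by division by \<open>v\<close>; for
    \<open>v = 0\<close> its value at any single point is already the claim.\<close>
  proof (cases "v = 0")
    case True
    then show ?thesis using bound[of 0] by simp
  next
    case False
    then have "\<bar>Phi_adj \<phi> q t\<bar> \<le> l2_inner q (Phi \<phi> m) / v" for t
      using v0 bound[of t] by (simp add: field_simps)
    then have "c \<le> l2_inner q (Phi \<phi> m) / v"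
      unfolding c_def using sup_norm_le_iff[OF Phi_adj_continuous[OF \<phi> q]] by blast
    then show ?thesis using False v0 by (simp add: field_simps)
  qed
  moreover have "l2_inner y q \<le> v * c"
    unfolding v_def c_def using dual_bound[OF sol q] by (simp add: y_def)
  ultimately have "(l2_norm q)\<^sup>2 \<le> 0" unfolding qm by linarith
  then have "AE t in haar. q t = 0" by (intro l2_norm_eq_0[OF q]) simp
  then have "AE t in haar. Phi \<phi> m t = y t" by eventually_elim (simp add: q_def)
  with m that show ?thesis by (auto simp: P0_feasible_def y_def v_def)
qed

text \<open>The scaled residual p is a subgradient of the total variation at m: by the first-order
  condition along segments, m maximises the integral of \<open>Phi_adj \<phi> p\<close> minus
  \<open>tv_norm\<close>. Point masses then extract both conclusions.\<close>

lemma solves_P_optimality: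
  assumes l: "0 < l" and y: "y \<in> L2" and sol: "solves_P \<phi> l y m"
  defines "p \<equiv> \<lambda>t. 1 / l * (y t - Phi \<phi> m t)"
  shows "p \<in> D0_feasible \<phi>" "tv_norm m \<le> signed_integral m (Phi_adj \<phi> p)"
proof -
  have m: "m \<in> radon_measures" "\<And>m'. m' \<in> radon_measures \<Longrightarrow> P_energy \<phi> l y m \<le> P_energy \<phi> l y m'"
    using sol l by (auto simp: solves_P_def)
  have L: "Phi \<phi> m \<in> L2" using Phi_L2[OF \<phi> m(1)] .
  have p: "p \<in> L2" unfolding p_def using y L by (intro L2_scale L2_diff)
  define \<eta> where "\<eta> = Phi_adj \<phi> p"
  have \<eta>: "continuous_on UNIV \<eta>" unfolding \<eta>_def using Phi_adj_continuous[OF \<phi> p] .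
  define k where "k = signed_integral m \<eta> - tv_norm m"
  have var: "signed_integral m' \<eta> - tv_norm m' \<le> k" if m': "m' \<in> radon_measures" for m'
  proof -
    define g where "g = l2_inner (\<lambda>t. Phi \<phi> m t - y t) (\<lambda>t. Phi \<phi> m' t - Phi \<phi> m t)"
    have "0 \<le> g + l * (tv_norm m' - tv_norm m)"
    proof (rule first_order_nonneg)
      fix s :: real assume s: "0 < s" "s \<le> 1"
      have "tv_norm (\<lambda>A. (1 - s) * m A + s * m' A) \<le> (1 - s) * tv_norm m + s * tv_norm m'"
        using s by (intro tv_norm_lincomb m m') auto
      from mult_left_mono[OF this less_imp_le[OF l]] m(2)[OF radon_lincomb[OF m(1) m', of "1 - s" s]]
      show "0 \<le> s * (g + l * (tv_norm m' - tv_norm m))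
          + s\<^sup>2 * (1/2 * (l2_norm (\<lambda>t. Phi \<phi> m' t - Phi \<phi> m t))\<^sup>2)"
        unfolding P_energy_def residual_segment[OF m(1) m' y] g_def by (simp add: algebra_simps)
    qed
    moreover have "g = - l * (l2_inner p (Phi \<phi> m') - l2_inner p (Phi \<phi> m))"
      unfolding g_def p_def l2_inner_scale_left using l y L Phi_L2[OF \<phi> m']
      by (simp add: l2_inner_diff_left l2_inner_diff_right L2_diff field_simps)
    ultimately have "l * (l2_inner p (Phi \<phi> m') - l2_inner p (Phi \<phi> m)) \<le> l * (tv_norm m' - tv_norm m)"
      by simp
    then have "l2_inner p (Phi \<phi> m') - l2_inner p (Phi \<phi> m) \<le> tv_norm m' - tv_norm m" using l by simp
    then show ?thesis
      by (simp add: k_def \<eta>_def signed_integral_Phi_adj[OF \<phi> m' p] signed_integral_Phi_adj[OF \<phi> m(1) p])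
  qed
  \<comment> \<open>Weights c of large modulus force |\<eta>| \<le> 1, and c = 0 gives k \<ge> 0,
    which is saturation.\<close>
  have pt: "c * \<eta> t - \<bar>c\<bar> \<le> k" for c t
    using var[OF radon_point_mass, of t c] tv_norm_point_mass[of t c]
    by (simp add: signed_integral_point_mass[OF \<eta>])
  have "\<bar>\<eta> t\<bar> \<le> 1" for t
  proof (rule ccontr)
    assume "\<not> \<bar>\<eta> t\<bar> \<le> 1"
    then have gt: "0 < \<bar>\<eta> t\<bar> - 1" by simp
    \<comment> \<open>The weight at which a point mass would reach |k| + 1 and so exceed the maximum
      k.\<close>
    define a where "a = (\<bar>k\<bar> + 1) / (\<bar>\<eta> t\<bar> - 1)"
    have a: "0 \<le> a" "a * (\<bar>\<eta> t\<bar> - 1) = \<bar>k\<bar> + 1" using gt by (auto simp: a_def)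
    have "a * \<bar>\<eta> t\<bar> - a \<le> k"
      using pt[of a t] pt[of "-a" t] a(1) by (cases "0 \<le> \<eta> t") auto
    with a(2) show False by (simp add: algebra_simps)
  qed
  then show "p \<in> D0_feasible \<phi>" using p by (simp add: D0_feasible_iff \<eta>_def)
  show "tv_norm m \<le> signed_integral m (Phi_adj \<phi> p)"
    using pt[of 0 0] by (simp add: k_def \<eta>_def)
qed

end

section \<open>The minimal norm certificate and its stability\<close>

lemma l2_parallelogram:
  assumes "p \<in> L2" "q \<in> L2"
  shows "(l2_norm (\<lambda>x. p x - q x))\<^sup>2
    = 2 * (l2_norm p)\<^sup>2 + 2 * (l2_norm q)\<^sup>2 - 4 * (l2_norm (\<lambda>x. 1/2 * (p x + q x)))\<^sup>2"
proof -
  have "4 * (l2_norm (\<lambda>x. 1/2 * (p x + q x)))\<^sup>2 = (l2_norm (\<lambda>x. p x + q x))\<^sup>2"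
    unfolding l2_norm_scale by (simp add: power_mult_distrib power_divide)
  then show ?thesis
    unfolding l2_norm_diff_square[OF assms] l2_norm_add_square[OF assms] by simp
qed

lemma l2_norm_limit:
  assumes q: "\<And>n. q n \<in> L2" "p \<in> L2" and lim: "(\<lambda>n. l2_norm (\<lambda>x. q n x - p x)) \<longlonglongrightarrow> 0"
  shows "(\<lambda>n. l2_norm (q n)) \<longlonglongrightarrow> l2_norm p"
proof (rule LIM_zero_cancel, rule tendsto_rabs_zero_cancel, rule tendsto_sandwich[OF _ _ tendsto_const lim])
  have "\<bar>l2_norm (q n) - l2_norm p\<bar> \<le> l2_norm (\<lambda>x. q n x - p x)" for n
    using l2_norm_triangle[OF L2_diff[OF q(1) q(2)] q(2), of n]
      l2_norm_triangle[OF L2_diff[OF q(2) q(1)] q(1), of n n]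
    by (simp add: l2_norm_diff_commute[of p])
  then show "eventually (\<lambda>n. \<bar>l2_norm (q n) - l2_norm p\<bar> \<le> l2_norm (\<lambda>x. q n x - p x)) sequentially"
    by simp
qed simp

lemma l2_inner_limit:
  assumes q: "\<And>n. q n \<in> L2" "p \<in> L2" and lim: "(\<lambda>n. l2_norm (\<lambda>x. q n x - p x)) \<longlonglongrightarrow> 0"
    and y: "y \<in> L2"
  shows "(\<lambda>n. l2_inner y (q n)) \<longlonglongrightarrow> l2_inner y p"
proof (rule LIM_zero_cancel, rule tendsto_rabs_zero_cancel, rule tendsto_sandwich[OF _ _ tendsto_const])
  have "\<bar>l2_inner y (q n) - l2_inner y p\<bar> \<le> l2_norm y * l2_norm (\<lambda>x. q n x - p x)" for n
    using l2_Cauchy_Schwarz[OF y L2_diff[OF q(1) q(2)], of n] by (simp add: l2_inner_diff_right[OF q(1) q(2) y])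
  then show "eventually (\<lambda>n. \<bar>l2_inner y (q n) - l2_inner y p\<bar> \<le> l2_norm y * l2_norm (\<lambda>x. q n x - p x)) sequentially"
    by simp
  show "(\<lambda>n. l2_norm y * l2_norm (\<lambda>x. q n x - p x)) \<longlonglongrightarrow> 0"
    using tendsto_mult_left[OF lim] by simp
qed simp

context
  fixes \<phi> :: "torus \<Rightarrow> real"
  assumes \<phi>: "continuous_on UNIV \<phi>"
begin

text \<open>L2 convergence implies convergence of the adjoint images at every point, by
  \<open>Phi_adj_bound\<close>.\<close>

lemma D0_feasible_closed:
  assumes q: "\<And>n. q n \<in> D0_feasible \<phi>" and p: "p \<in> L2"
    and lim: "(\<lambda>n. l2_norm (\<lambda>x. q n x - p x)) \<longlonglongrightarrow> 0"
  shows "p \<in> D0_feasible \<phi>"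
proof -
  have L: "q n \<in> L2" for n using q by (rule D0_feasible_L2)
  have "\<bar>Phi_adj \<phi> p t\<bar> \<le> 1" for t
  proof (rule LIMSEQ_le_const)
    show "(\<lambda>n. 1 + sup_norm \<phi> * l2_norm (\<lambda>x. q n x - p x)) \<longlonglongrightarrow> 1"
      using tendsto_add[OF tendsto_const tendsto_mult_left[OF lim]] by force
    have "\<bar>Phi_adj \<phi> p t\<bar> \<le> 1 + sup_norm \<phi> * l2_norm (\<lambda>x. q n x - p x)" for n
    proof -
      have "\<bar>Phi_adj \<phi> (q n) t - Phi_adj \<phi> p t\<bar> \<le> sup_norm \<phi> * l2_norm (\<lambda>x. q n x - p x)"
        using Phi_adj_bound[OF \<phi> L2_diff[OF L p], of n t] unfolding Phi_adj_diff[OF \<phi> L p] .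
      moreover have "\<bar>Phi_adj \<phi> (q n) t\<bar> \<le> 1" using q[of n] by (simp add: D0_feasible_iff[OF \<phi>])
      ultimately show ?thesis by linarith
    qed
    then show "\<exists>N. \<forall>n\<ge>N. \<bar>Phi_adj \<phi> p t\<bar> \<le> 1 + sup_norm \<phi> * l2_norm (\<lambda>x. q n x - p x)" by blast
  qed
  then show ?thesis using p by (simp add: D0_feasible_iff[OF \<phi>])
qed

text \<open>
  Near-minimisers of the norm over the slices \<open>{q feasible | \<langle>y, q\<rangle> \<ge> v - 1/(n+1)}\<close> form a Cauchy
  sequence by the parallelogram law, and their limit is a solution of least norm. This gives the
  existence of the limit certificate and, at the same time, its stability.
\<close>

lemma minimal_norm_solution:
  assumes y: "y \<in> L2" and sol: "solves_D0 \<phi> y p1"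
  shows "\<exists>p. min_norm_solves_D0 \<phi> y p"
    and "min_norm_solves_D0 \<phi> y p0 \<Longrightarrow> 0 < e \<Longrightarrow>
      \<exists>s>0. \<forall>q\<in>D0_feasible \<phi>. l2_inner y p0 - s \<le> l2_inner y q \<longrightarrow> (l2_norm p0)\<^sup>2 - e \<le> (l2_norm q)\<^sup>2"
proof -
  define v where "v = l2_inner y p1"
  have opt: "q \<in> D0_feasible \<phi> \<Longrightarrow> l2_inner y q \<le> v" for q using sol by (simp add: solves_D0_def v_def)
  define h where "h n = inverse (real (Suc n))" for n
  have h: "0 < h n" for n by (simp add: h_def)
  have h_mono: "h k \<le> h n" if "n \<le> k" for n k using that by (simp add: h_def)
  have h_lim: "h \<longlonglongrightarrow> 0" unfolding h_def by (rule LIMSEQ_inverse_real_of_nat)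
  \<comment> \<open>The slices decrease with n and each contains every dual solution, so the infima
    \<open>D n\<close> increase and are bounded by the squared norm of \<open>p1\<close>.\<close>
  define C where "C n = {q \<in> D0_feasible \<phi>. v - h n \<le> l2_inner y q}" for n
  define D where "D n = (INF q\<in>C n. (l2_norm q)\<^sup>2)" for n
  have CL: "q \<in> L2" if "q \<in> C n" for q n using that by (auto simp: C_def intro: D0_feasible_L2)
  have bdd: "bdd_below ((\<lambda>q. (l2_norm q)\<^sup>2) ` C n)" for n by (intro bdd_belowI2[of _ 0]) simp
  have D_le: "D n \<le> (l2_norm q)\<^sup>2" if "q \<in> C n" for q n
    unfolding D_def using bdd that by (rule cINF_lower)
  have sol_C: "q \<in> C n" if "q \<in> D0_feasible \<phi>" "l2_inner y q = v" for q n
    using that h[of n] by (simp add: C_def)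
  have p1_C: "p1 \<in> C n" for n using sol by (intro sol_C) (auto simp: solves_D0_def v_def)
  have C_anti: "C k \<subseteq> C n" if "n \<le> k" for n k using h_mono[OF that] by (auto simp: C_def)
  have D_mono: "D n \<le> D k" if "n \<le> k" for n k
    unfolding D_def using C_anti[OF that] p1_C bdd by (intro cINF_superset_mono) auto
  obtain d where d: "D \<longlonglongrightarrow> d" "\<And>n. D n \<le> d"
    using incseq_convergent[of D "(l2_norm p1)\<^sup>2"] D_mono D_le[OF p1_C] by (auto simp: incseq_def)
  have "\<exists>q. q \<in> C n \<and> (l2_norm q)\<^sup>2 < D n + h n" for n
  proof -
    have "(INF q\<in>C n. (l2_norm q)\<^sup>2) < D n + h n" using h[of n] by (simp add: D_def)
    moreover have "C n \<noteq> {}" using p1_C by blast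
    ultimately show ?thesis using cINF_less_iff[OF _ bdd, of n "D n + h n"] by blast
  qed
  then obtain q where q: "\<And>n. q n \<in> C n" "\<And>n. (l2_norm (q n))\<^sup>2 < D n + h n" by metis
  have qL: "q n \<in> L2" for n using q(1) by (rule CL)
  have qF: "q n \<in> D0_feasible \<phi>" for n using q(1)[of n] by (simp add: C_def)
  have mid: "(\<lambda>x. 1/2 * (p x + p' x)) \<in> C n" if "p \<in> C n" "p' \<in> C n" for p p' n
  proof -
    have "l2_inner y (\<lambda>x. 1/2 * (p x + p' x)) = 1/2 * (l2_inner y p + l2_inner y p')"
      unfolding l2_inner_scale_right using that y by (simp add: l2_inner_add_right CL)
    then show ?thesis using that D0_feasible_midpoint[OF \<phi>, of p p'] by (auto simp: C_def)
  qed
  \<comment> \<open>For n \<le> k both vectors lie in \<open>C n\<close>, hence so does their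
    midpoint, whose squared norm is at least \<open>D n\<close>; this is the subtracted term of the
    parallelogram law.\<close>
  have dist_le: "(l2_norm (\<lambda>x. q n x - q k x))\<^sup>2 \<le> 2 * (d - D n) + 4 * h n" if "n \<le> k" for n k
  proof -
    have "q k \<in> C n" using q(1)[of k] C_anti[OF that] by blast
    from D_le[OF mid[OF q(1)[of n] this]]
    have "(l2_norm (\<lambda>x. q n x - q k x))\<^sup>2 \<le> 2 * (l2_norm (q n))\<^sup>2 + 2 * (l2_norm (q k))\<^sup>2 - 4 * D n"
      unfolding l2_parallelogram[OF qL qL] by simp
    then show ?thesis
      using q(2)[of n] q(2)[of k] h_mono[OF that] d(2)[of k] unfolding right_diff_distrib by linarith
  qed
  have "(\<lambda>n. 2 * (d - D n) + 4 * h n) \<longlonglongrightarrow> 2 * (d - d) + 4 * 0"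
    by (intro tendsto_intros d h_lim)
  then have small: "\<exists>N. 2 * (d - D N) + 4 * h N < r" if "0 < r" for r
    using order_tendstoD(2)[of _ 0 sequentially r] that by (force simp: eventually_sequentially)
  have cauchy: "\<exists>N. \<forall>i\<ge>N. \<forall>j\<ge>N. l2_norm (\<lambda>x. q i x - q j x) < r" if r: "0 < r" for r
  proof -
    \<comment> \<open>\<open>dist_le\<close> treats only ordered pairs, so both indices are compared
      with \<open>N\<close>, each at a cost below r/2.\<close>
    obtain N where N: "2 * (d - D N) + 4 * h N < (r / 2)\<^sup>2" using small[of "(r/2)\<^sup>2"] r by auto
    have near: "l2_norm (\<lambda>x. q N x - q k x) < r / 2" if "N \<le> k" for k
      by (rule power2_less_imp_less[OF le_less_trans[OF dist_le[OF that] N]]) (use r in simp)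
    have "l2_norm (\<lambda>x. q i x - q j x) < r" if "N \<le> i" "N \<le> j" for i j
      using l2_norm_triangle[OF L2_diff[OF qL qL] L2_diff[OF qL qL], of i N N j] near[OF that(1)] near[OF that(2)]
      by (simp add: l2_norm_diff_commute[of "q i" "q N"])
    then show ?thesis by blast
  qed
  obtain p where p: "p \<in> L2" "(\<lambda>n. l2_norm (\<lambda>x. q n x - p x)) \<longlonglongrightarrow> 0"
    using L2_complete[of q, OF qL cauchy] by blast
  have pF: "p \<in> D0_feasible \<phi>" using D0_feasible_closed[OF qF p] .
  have "v \<le> l2_inner y p"
  proof (rule LIMSEQ_le[OF _ l2_inner_limit[OF qL p y]])
    show "(\<lambda>n. v - h n) \<longlonglongrightarrow> v" using tendsto_diff[OF tendsto_const h_lim] by force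
    show "\<exists>N. \<forall>n\<ge>N. v - h n \<le> l2_inner y (q n)" using q(1) by (auto simp: C_def)
  qed
  then have pv: "l2_inner y p = v" using opt[OF pF] by simp
  have p_d: "(l2_norm p)\<^sup>2 \<le> d"
  proof (rule LIMSEQ_le)
    show "(\<lambda>n. (l2_norm (q n))\<^sup>2) \<longlonglongrightarrow> (l2_norm p)\<^sup>2" by (intro tendsto_power l2_norm_limit[OF qL p])
    show "(\<lambda>n. D n + h n) \<longlonglongrightarrow> d" using tendsto_add[OF d(1) h_lim] by simp
    show "\<exists>N. \<forall>n\<ge>N. (l2_norm (q n))\<^sup>2 \<le> D n + h n" using q(2) by (auto intro: less_imp_le)
  qed
  have sol_iff: "solves_D0 \<phi> y r \<longleftrightarrow> r \<in> D0_feasible \<phi> \<and> l2_inner y r = v" for r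
    unfolding solves_D0_def using opt pF pv by (metis antisym)
  \<comment> \<open>A solution lies in every slice, so its squared norm dominates every
    \<open>D n\<close> and hence the limit.\<close>
  have d_le: "d \<le> (l2_norm r)\<^sup>2" if "solves_D0 \<phi> y r" for r
    using that sol_iff D_le[OF sol_C] by (intro LIMSEQ_le_const2[OF d(1)]) blast
  have "l2_norm p \<le> l2_norm r" if "solves_D0 \<phi> y r" for r
    using order_trans[OF p_d d_le[OF that]] by (rule power2_le_imp_le) (rule l2_norm_nonneg)
  then have min: "min_norm_solves_D0 \<phi> y p"
    unfolding min_norm_solves_D0_def using sol_iff pF pv by blast
  then show "\<exists>p. min_norm_solves_D0 \<phi> y p" by blast
  show "\<exists>s>0. \<forall>q\<in>D0_feasible \<phi>. l2_inner y p0 - s \<le> l2_inner y q \<longrightarrow> (l2_norm p0)\<^sup>2 - e \<le> (l2_norm q)\<^sup>2"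
    if p0: "min_norm_solves_D0 \<phi> y p0" and e: "0 < e"
  proof -
    have p0': "solves_D0 \<phi> y p0" "l2_norm p0 \<le> l2_norm p"
      using p0 min by (auto simp: min_norm_solves_D0_def)
    have "(l2_norm p0)\<^sup>2 \<le> d"
      using power_mono[OF p0'(2) l2_norm_nonneg, of 2] p_d by simp
    \<comment> \<open>The depth \<open>h n\<close> of this slice is the required s.\<close>
    moreover obtain n where "d - e < D n"
      using order_tendstoD(1)[OF d(1), of "d - e"] e by (auto simp: eventually_sequentially)
    ultimately have "(l2_norm p0)\<^sup>2 - e \<le> D n" by simp
    moreover have "l2_inner y p0 = v" using p0'(1) sol_iff by simp
    ultimately show ?thesis
      using D_le[of _ n] h[of n] by (intro exI[of _ "h n"]) (auto simp: C_def intro: order_trans)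
  qed
qed

text \<open>Since p saturates on m while p0 is merely feasible, <p0 - p, Phi m> \<le> 0.
  Substituting Phi m = y + w - l p gives g + <p0 - p, w> + l (|p|^2 - <p0, p>) \<le> 0, where g
  \<ge> 0 is the dual gap of p. Dropping g and dividing by l bounds the norm of p; keeping g shows
  that it is O(l).\<close>

lemma certificate_estimates:
  assumes m: "m \<in> radon_measures" and y: "y \<in> L2" and w: "w \<in> L2" "l2_norm w \<le> \<alpha> * l" "0 \<le> \<alpha>" "\<alpha> \<le> 1"
    and l: "0 < l" and p0: "solves_D0 \<phi> y p0"
  defines "p \<equiv> \<lambda>t. 1 / l * (y t + w t - Phi \<phi> m t)"
  assumes p: "p \<in> D0_feasible \<phi>" "tv_norm m \<le> signed_integral m (Phi_adj \<phi> p)"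
  shows "l2_norm p \<le> l2_norm p0 + 2 * \<alpha>"
    and "l2_inner y p0 - l * ((2 * l2_norm p0 + 2) * (l2_norm p0 + 3)) \<le> l2_inner y p"
proof -
  define R where "R = l2_norm p0"
  define r where "r = l2_norm p"
  have nonneg: "0 \<le> R" "0 \<le> r" by (simp_all add: R_def r_def l2_norm_nonneg)
  have p0F: "p0 \<in> D0_feasible \<phi>" using p0 by (simp add: solves_D0_def)
  have L: "p0 \<in> L2" "p \<in> L2" "Phi \<phi> m \<in> L2"
    using p0F p(1) Phi_L2[OF \<phi> m] by (simp_all add: D0_feasible_L2)
  have "signed_integral m (Phi_adj \<phi> p0) \<le> tv_norm m"
    using p0F by (intro signed_integral_le_tv_norm m Phi_adj_continuous[OF \<phi>])
      (auto simp: D0_feasible_iff[OF \<phi>])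
  then have "l2_inner p0 (Phi \<phi> m) \<le> l2_inner p (Phi \<phi> m)"
    using p(2) by (simp add: signed_integral_Phi_adj[OF \<phi> m] L)
  then have "l2_inner (\<lambda>t. p0 t - p t) (Phi \<phi> m) \<le> 0"
    using L by (simp add: l2_inner_diff_left)
  moreover have "Phi \<phi> m = (\<lambda>t. y t + (w t - l * p t))"
    using l by (simp add: p_def)
  ultimately have main: "l2_inner (\<lambda>t. p0 t - p t) (\<lambda>t. y t + (w t - l * p t)) \<le> 0" by simp
  define g where "g = l2_inner y p0 - l2_inner y p"
  define u where "u = l2_inner (\<lambda>t. p0 t - p t) w"
  have g0: "0 \<le> g" using p0 p(1) by (simp add: g_def solves_D0_def)
  have "l2_norm (\<lambda>t. p0 t - p t) \<le> R + r"
    using l2_norm_triangle[OF L(1) L2_scale[OF L(2)], of "-1"] l2_norm_scale[of "-1" p]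
    by (simp add: R_def r_def)
  then have "\<bar>u\<bar> \<le> (R + r) * (\<alpha> * l)"
    unfolding u_def using w(2) nonneg
    by (intro order_trans[OF l2_Cauchy_Schwarz[OF L2_diff[OF L(1,2)] w(1)]] mult_mono l2_norm_nonneg) auto
  moreover have expand: "g + u - l * (l2_inner p0 p - r\<^sup>2) \<le> 0"
    using main y w L unfolding g_def u_def r_def l2_norm_square
    by (simp add: l2_inner_add_right l2_inner_diff_right l2_inner_scale_right l2_inner_diff_left
        L2_add L2_diff L2_scale l2_inner_commute[of y])
  ultimately have e1: "g + l * (r\<^sup>2 - l2_inner p0 p) \<le> l * (\<alpha> * (R + r))"
    by (simp add: algebra_simps)
  have cs: "l2_inner p0 p \<le> R * r" using l2_Cauchy_Schwarz[OF L(1,2)] by (simp add: R_def r_def)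
  have "l * (r\<^sup>2 - l2_inner p0 p) \<le> l * (\<alpha> * (R + r))" using e1 g0 by simp
  then have "r\<^sup>2 - R * r \<le> \<alpha> * (R + r)" using l cs by simp
  then have r_le: "r \<le> R + 2 * \<alpha>"
  proof -
    assume *: "r\<^sup>2 - R * r \<le> \<alpha> * (R + r)"
    show ?thesis
    proof (rule ccontr)
      assume "\<not> r \<le> R + 2 * \<alpha>"
      then have gt: "R + 2 * \<alpha> < r" by simp
      then have "0 < r" "R \<le> r" using nonneg w by linarith+
      have "\<alpha> * (R + r) \<le> \<alpha> * (2 * r)" using \<open>R \<le> r\<close> w by (intro mult_left_mono) auto
      then have "r * (r - R - 2 * \<alpha>) \<le> 0" using * by (simp add: power2_eq_square algebra_simps)
      moreover have "0 < r * (r - R - 2 * \<alpha>)" using gt \<open>0 < r\<close> by simp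
      ultimately show False by simp
    qed
  qed
  then show "l2_norm p \<le> l2_norm p0 + 2 * \<alpha>" by (simp add: R_def r_def)
  have "g \<le> l * (\<alpha> * (R + r) + (l2_inner p0 p - r\<^sup>2))" using e1 by (simp add: algebra_simps)
  \<comment> \<open>With \<alpha> \<le> 1 and r \<le> R + 2 the bracket is at most R^2 + 4 R + 2;
    the product is a convenient overestimate that depends on R alone.\<close>
  also have "\<dots> \<le> l * ((2 * R + 2) * (R + 3))"
  proof (intro mult_left_mono)
    have r2: "r \<le> R + 2" using r_le w by linarith
    have "\<alpha> * (R + r) \<le> 1 * (R + (R + 2))" using r2 w nonneg by (intro mult_mono) auto
    moreover have "R * r \<le> R * (R + 2)" using r2 nonneg by (intro mult_left_mono) auto
    moreover have "0 \<le> r\<^sup>2" "0 \<le> R * R" using nonneg by simp_all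
    moreover have "R * (R + 2) = R * R + 2 * R" "(2 * R + 2) * (R + 3) = 2 * (R * R) + 8 * R + 6"
      "1 * (R + (R + 2)) = 2 * R + 2"
      by (simp_all add: algebra_simps)
    ultimately show "\<alpha> * (R + r) + (l2_inner p0 p - r\<^sup>2) \<le> (2 * R + 2) * (R + 3)"
      using cs nonneg(1) by linarith
  qed (use l in simp)
  finally show "l2_inner y p0 - l * ((2 * l2_norm p0 + 2) * (l2_norm p0 + 3)) \<le> l2_inner y p"
    by (simp add: g_def R_def)
qed

text \<open>The two estimates for p are fed into the stability of the minimal norm: \<alpha> is
  fixed from the norm estimate, the bound on l from the gap estimate.\<close>

lemma certificates_converge:
  assumes m0: "m0 \<in> radon_measures" and p0: "min_norm_solves_D0 \<phi> (Phi \<phi> m0) p0" and d: "0 < d"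
  shows "\<exists>\<alpha>>0. \<exists>l0>0. \<forall>(l, w)\<in>noise_region \<alpha> l0. \<forall>m. solves_P \<phi> l (\<lambda>t. Phi \<phi> m0 t + w t) m \<longrightarrow>
    m \<in> radon_measures \<and> (\<exists>p\<in>D0_feasible \<phi>. l2_norm (\<lambda>x. p x - p0 x) \<le> d \<and>
      tv_norm m \<le> signed_integral m (Phi_adj \<phi> p))"
proof -
  define y where "y = Phi \<phi> m0"
  have y: "y \<in> L2" using Phi_L2[OF \<phi> m0] by (simp add: y_def)
  have sol: "solves_D0 \<phi> y p0" and min: "min_norm_solves_D0 \<phi> y p0"
    using p0 by (auto simp: y_def min_norm_solves_D0_def)
  have p0F: "p0 \<in> D0_feasible \<phi>" using sol by (simp add: solves_D0_def)
  then have p0L: "p0 \<in> L2" by (rule D0_feasible_L2)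
  define R where "R = l2_norm p0"
  have R: "0 \<le> R" by (simp add: R_def l2_norm_nonneg)
  \<comment> \<open>The parallelogram law multiplies this loss by 4, so d^2/8 uses up half of the
    budget d^2.\<close>
  obtain s where s: "0 < s" "\<And>q. q \<in> D0_feasible \<phi> \<Longrightarrow> l2_inner y p0 - s \<le> l2_inner y q \<Longrightarrow>
      R\<^sup>2 - d\<^sup>2 / 8 \<le> (l2_norm q)\<^sup>2"
    using minimal_norm_solution(2)[OF y sol min, of "d\<^sup>2 / 8"] d by (auto simp: R_def)
  \<comment> \<open>The other half: the excess norm contributes at most 8 \<alpha> (R + 1), which is
    at most d^2/2.\<close>
  define \<alpha> where "\<alpha> = min 1 (d\<^sup>2 / (16 * (R + 1)))"
  have \<alpha>: "0 < \<alpha>" "\<alpha> \<le> 1" "\<alpha> * (16 * (R + 1)) \<le> d\<^sup>2"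
  proof -
    have "\<alpha> \<le> d\<^sup>2 / (16 * (R + 1))" by (simp add: \<alpha>_def)
    then show "\<alpha> * (16 * (R + 1)) \<le> d\<^sup>2" using R by (simp add: pos_le_divide_eq)
  qed (use d R in \<open>auto simp: \<alpha>_def\<close>)
  \<comment> \<open>The rate of the dual gap in \<open>certificate_estimates\<close>; l \<le> s / G
    keeps the gap below s.\<close>
  define G where "G = (2 * R + 2) * (R + 3)"
  have G: "0 < G" unfolding G_def using R by (intro mult_pos_pos) auto
  have goal: "m \<in> radon_measures \<and> (\<exists>p\<in>D0_feasible \<phi>. l2_norm (\<lambda>x. p x - p0 x) \<le> d \<and>
      tv_norm m \<le> signed_integral m (Phi_adj \<phi> p))"
    if lw: "(l, w) \<in> noise_region \<alpha> (s / G)" and mP: "solves_P \<phi> l (\<lambda>t. y t + w t) m" for l w m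
  proof -
    have w: "w \<in> L2" "0 \<le> l" "l \<le> s / G" "l2_norm w \<le> \<alpha> * l" using lw by (auto simp: noise_region_def)
    have m: "m \<in> radon_measures" using mP by (auto simp: solves_P_def P0_feasible_def split: if_splits)
    show ?thesis
    proof (cases "l = 0")
      case True
      then have "l2_norm w = 0" using w(4) l2_norm_nonneg[of w] by simp
      then have w0: "AE t in haar. w t = 0" using l2_norm_eq_0[OF w(1)] by blast
      have feas: "m \<in> P0_feasible \<phi> (\<lambda>t. y t + w t)"
        "\<And>m'. m' \<in> P0_feasible \<phi> (\<lambda>t. y t + w t) \<Longrightarrow> tv_norm m \<le> tv_norm m'"
        using mP True by (auto simp: solves_P_def)
      \<comment> \<open>Because \<open>m0\<close> need not be a minimiser, the bound on
        \<open>tv_norm m\<close> comes from the competitor supplied by strong duality, feasible here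
        because w vanishes almost everywhere.\<close>
      obtain m' where m': "m' \<in> P0_feasible \<phi> y" "tv_norm m' \<le> l2_inner y p0"
        using strong_duality[OF \<phi> m0] sol unfolding y_def by blast
      have "AE t in haar. Phi \<phi> m' t = y t" using m'(1) by (simp add: P0_feasible_def)
      with w0 have "AE t in haar. Phi \<phi> m' t = y t + w t" by eventually_elim simp
      then have "m' \<in> P0_feasible \<phi> (\<lambda>t. y t + w t)" using m'(1) by (simp add: P0_feasible_def)
      then have le: "tv_norm m \<le> l2_inner y p0" using feas(2) m'(2) order_trans by blast
      have "AE t in haar. Phi \<phi> m t = y t + w t" using feas(1) by (simp add: P0_feasible_def)
      with w0 have "AE t in haar. Phi \<phi> m t = y t" by eventually_elim simp
      then have "l2_inner (Phi \<phi> m) p0 = l2_inner y p0"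
        using p0L L2_measurable Phi_L2[OF \<phi> m] y by (intro l2_inner_cong_AE) auto
      then have "signed_integral m (Phi_adj \<phi> p0) = l2_inner y p0"
        by (simp add: signed_integral_Phi_adj[OF \<phi> m p0L] l2_inner_commute[of p0])
      with le show ?thesis using m p0F d by (intro conjI bexI[of _ p0]) (auto simp: l2_norm_def l2_inner_def)
    next
      case False
      then have l: "0 < l" using w by simp
      define p where "p t = 1 / l * (y t + w t - Phi \<phi> m t)" for t
      have p: "p \<in> D0_feasible \<phi>" "tv_norm m \<le> signed_integral m (Phi_adj \<phi> p)"
        using solves_P_optimality[OF \<phi> l L2_add[OF y w(1)] mP] by (simp_all add: p_def[abs_def])
      have pL: "p \<in> L2" using p(1) by (rule D0_feasible_L2)
      have est: "l2_norm p \<le> R + 2 * \<alpha>" "l2_inner y p0 - l * G \<le> l2_inner y p"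
        using certificate_estimates[OF m y w(1,4) _ \<alpha>(2) l sol] p \<alpha>(1)
        unfolding p_def[abs_def, symmetric] R_def G_def by auto
      have "l * G \<le> s" using w(3) G by (simp add: pos_le_divide_eq)
      then have "l2_inner y p0 - s \<le> l2_inner y p" using est(2) by simp
      moreover have "l2_inner y (\<lambda>x. 1/2 * (p x + p0 x)) = 1/2 * (l2_inner y p + l2_inner y p0)"
        unfolding l2_inner_scale_right using pL p0L y by (simp add: l2_inner_add_right)
      \<comment> \<open>The midpoint inherits the value bound from its two endpoints, so the norm
        bound of the slice applies to it.\<close>
      ultimately have "l2_inner y p0 - s \<le> l2_inner y (\<lambda>x. 1/2 * (p x + p0 x))" using s(1) by simp
      then have "R\<^sup>2 - d\<^sup>2 / 8 \<le> (l2_norm (\<lambda>x. 1/2 * (p x + p0 x)))\<^sup>2"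
        using s(2) D0_feasible_midpoint[OF \<phi> p(1) p0F] by blast
      moreover have "(l2_norm p)\<^sup>2 \<le> (R + 2 * \<alpha>)\<^sup>2" using est(1) by (intro power_mono l2_norm_nonneg)
      ultimately have "(l2_norm (\<lambda>x. p x - p0 x))\<^sup>2 \<le> 2 * (R + 2 * \<alpha>)\<^sup>2 - 2 * R\<^sup>2 + d\<^sup>2 / 2"
        unfolding l2_parallelogram[OF pL p0L] by (simp add: R_def)
      also have "2 * (R + 2 * \<alpha>)\<^sup>2 - 2 * R\<^sup>2 = 8 * \<alpha> * (R + \<alpha>)" by (simp add: power2_eq_square algebra_simps)
      also have "8 * \<alpha> * (R + \<alpha>) \<le> 8 * \<alpha> * (R + 1)" using \<alpha> by (intro mult_left_mono) auto
      finally have "(l2_norm (\<lambda>x. p x - p0 x))\<^sup>2 \<le> d\<^sup>2"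
        using \<alpha>(3) by (simp add: algebra_simps)
      then have "l2_norm (\<lambda>x. p x - p0 x) \<le> d" by (rule power2_le_imp_le) (use d in simp)
      with m p(2) show ?thesis by (intro conjI bexI[OF _ p(1)])
    qed
  qed
  have "0 < s / G" using s(1) G by simp
  with \<alpha>(1) goal show ?thesis unfolding y_def by blast
qed

end

section \<open>From closeness of certificates to localisation of supports\<close>

theorem lemma1:
  fixes \<phi> :: "torus \<Rightarrow> real"
    and m\<^sub>0 :: "torus set \<Rightarrow> real"
    and y\<^sub>0 :: "torus \<Rightarrow> real"
    and \<epsilon> :: real
  assumes "C2_torus \<phi>"
    and "m\<^sub>0 \<in> radon_measures"
    and "y\<^sub>0 = Phi \<phi> m\<^sub>0"
    and "\<exists>p. solves_D0 \<phi> y\<^sub>0 p"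
    and "\<epsilon> > 0"
  shows "\<exists>\<alpha>>0. \<exists>l\<^sub>0>0. \<forall>(l, w)\<in>noise_region \<alpha> l\<^sub>0. \<forall>m.
    solves_P \<phi> l (\<lambda>t. y\<^sub>0 t + w t) m \<longrightarrow>
    signed_supp m \<subseteq> ext_signed_supp \<phi> m\<^sub>0 + (to_torus ` {-\<epsilon><..<\<epsilon>} \<times> {0})"
proof -
  have \<phi>: "continuous_on UNIV \<phi>" using assms(1) by (rule C2_torus_continuous)
  have y: "y\<^sub>0 \<in> L2" using Phi_L2[OF \<phi> assms(2)] assms(3) by simp
  define p\<^sub>0 where "p\<^sub>0 = (SOME p. min_norm_solves_D0 \<phi> y\<^sub>0 p)"
  define \<eta>\<^sub>0 where "\<eta>\<^sub>0 = Phi_adj \<phi> p\<^sub>0"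
  have min: "min_norm_solves_D0 \<phi> y\<^sub>0 p\<^sub>0"
    unfolding p\<^sub>0_def using minimal_norm_solution(1)[OF \<phi> y] assms(4) by (metis someI_ex)
  then have p0F: "p\<^sub>0 \<in> D0_feasible \<phi>" by (simp add: min_norm_solves_D0_def solves_D0_def)
  then have p0L: "p\<^sub>0 \<in> L2" by (rule D0_feasible_L2)
  have \<eta>\<^sub>0: "continuous_on UNIV \<eta>\<^sub>0" "\<And>t. \<bar>\<eta>\<^sub>0 t\<bar> \<le> 1"
    using p0F Phi_adj_continuous[OF \<phi> p0L] by (auto simp: \<eta>\<^sub>0_def D0_feasible_iff[OF \<phi>])
  have le1: "\<eta>\<^sub>0 t \<le> 1" "- \<eta>\<^sub>0 t \<le> 1" for t using \<eta>\<^sub>0(2)[of t] by (simp_all add: abs_le_iff)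
  have ext: "ext_signed_supp \<phi> m\<^sub>0 = {(t, v). v \<in> {1, -1} \<and> \<eta>\<^sub>0 t = v}"
    by (simp add: ext_signed_supp_def min_norm_certificate_def \<eta>\<^sub>0_def p\<^sub>0_def assms(3))
  obtain a where a: "0 < a" "\<And>t. 1 - a < \<eta>\<^sub>0 t \<Longrightarrow> \<exists>s. \<eta>\<^sub>0 s = 1 \<and> dist t s < \<epsilon>"
    using near_maximum_near_maximiser[OF \<eta>\<^sub>0(1) le1(1) assms(5)] by blast
  obtain b where b: "0 < b" "\<And>t. 1 - b < - \<eta>\<^sub>0 t \<Longrightarrow> \<exists>s. - \<eta>\<^sub>0 s = 1 \<and> dist t s < \<epsilon>"
    using near_maximum_near_maximiser[OF continuous_on_minus[OF \<eta>\<^sub>0(1)] le1(2) assms(5)] by blast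
  \<comment> \<open>The summand 1 makes the bound positive even for \<phi> = 0, so that it can be
    divided by.\<close>
  define c where "c = sup_norm \<phi> + 1"
  have c: "0 < c" "sup_norm \<phi> < c" using sup_norm_kernel_nonneg[OF \<phi>] by (simp_all add: c_def)
  \<comment> \<open>Uniform error c d is half of the smaller threshold, which turns the closed bound
    \<open>close\<close> into the strict inequalities asked for by \<open>a\<close> and
    \<open>b\<close>.\<close>
  define d where "d = min a b / (2 * c)"
  have d: "0 < d" "c * d < a" "c * d < b" using a(1) b(1) c by (auto simp: d_def)
  obtain \<alpha> l\<^sub>0 where \<alpha>: "0 < \<alpha>" "0 < l\<^sub>0" and conv: "\<And>l w m. (l, w) \<in> noise_region \<alpha> l\<^sub>0 \<Longrightarrow>
      solves_P \<phi> l (\<lambda>t. y\<^sub>0 t + w t) m \<Longrightarrow> m \<in> radon_measures \<and> (\<exists>p\<in>D0_feasible \<phi>.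
        l2_norm (\<lambda>x. p x - p\<^sub>0 x) \<le> d \<and> tv_norm m \<le> signed_integral m (Phi_adj \<phi> p))"
    using certificates_converge[OF \<phi> assms(2) min[unfolded assms(3)] d(1)] assms(3) by blast
  have "signed_supp m \<subseteq> ext_signed_supp \<phi> m\<^sub>0 + (to_torus ` {-\<epsilon><..<\<epsilon>} \<times> {0})"
    if lw: "(l, w) \<in> noise_region \<alpha> l\<^sub>0" and mP: "solves_P \<phi> l (\<lambda>t. y\<^sub>0 t + w t) m" for l w m
  proof (rule subrelI)
    fix t v assume tv: "(t, v) \<in> signed_supp m"
    obtain p where p: "p \<in> D0_feasible \<phi>" "l2_norm (\<lambda>x. p x - p\<^sub>0 x) \<le> d"
      "tv_norm m \<le> signed_integral m (Phi_adj \<phi> p)" and m: "m \<in> radon_measures"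
      using conv[OF lw mP] by blast
    have pL: "p \<in> L2" using p(1) by (rule D0_feasible_L2)
    have v: "v \<in> {1, -1}" "Phi_adj \<phi> p t = v"
      using saturated_signed_supp[OF m Phi_adj_continuous[OF \<phi> pL] _ p(3) tv] p(1)
      by (auto simp: D0_feasible_iff[OF \<phi>])
    have "\<bar>Phi_adj \<phi> p t - \<eta>\<^sub>0 t\<bar> \<le> sup_norm \<phi> * l2_norm (\<lambda>x. p x - p\<^sub>0 x)"
      using Phi_adj_bound[OF \<phi> L2_diff[OF pL p0L], of t] by (simp add: Phi_adj_diff[OF \<phi> pL p0L] \<eta>\<^sub>0_def)
    also have "\<dots> \<le> c * d"
      using p(2) c sup_norm_kernel_nonneg[OF \<phi>] by (intro mult_mono) (auto simp: l2_norm_nonneg)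
    finally have close: "\<bar>v - \<eta>\<^sub>0 t\<bar> \<le> c * d" by (simp add: v(2))
    have "\<exists>s. \<eta>\<^sub>0 s = v \<and> dist t s < \<epsilon>"
      using v(1)
    proof (elim insertE emptyE)
      assume "v = 1"
      then show ?thesis using a(2)[of t] close d(2) by (auto simp: abs_le_iff)
    next
      assume "v = -1"
      moreover have "\<exists>s. - \<eta>\<^sub>0 s = 1 \<and> dist t s < \<epsilon>"
        using b(2)[of t] close d(3) \<open>v = -1\<close> by (auto simp: abs_le_iff)
      ultimately show ?thesis by (metis minus_minus)
    qed
    then obtain s where s: "\<eta>\<^sub>0 s = v" "dist t s < \<epsilon>" by blast
    obtain x where x: "s = to_torus x" using to_torus_surj by blast
    \<comment> \<open>Among the representatives of t the one nearest to x is taken, so that the real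
      shift r - x has modulus equal to the torus distance.\<close>
    obtain r where r: "to_torus r = t" "\<bar>r - x\<bar> = dist t (to_torus x)" using dist_torus_witness by blast
    have "t = s + to_torus (r - x)" by (simp add: x to_torus_add r(1))
    then have "(t, v) = (s, v) + (to_torus (r - x), 0)" by simp
    moreover have "(s, v) \<in> ext_signed_supp \<phi> m\<^sub>0" using s(1) v(1) by (simp add: ext)
    moreover have "r - x \<in> {-\<epsilon><..<\<epsilon>}" using r(2) s(2) x by (auto simp: abs_less_iff)
    ultimately show "(t, v) \<in> ext_signed_supp \<phi> m\<^sub>0 + (to_torus ` {-\<epsilon><..<\<epsilon>} \<times> {0})"
      by (metis (no_types, lifting) set_plus_intro imageI SigmaI singletonI)
  qed
  with \<alpha> show ?thesis by blast
qed

end
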